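(* Let $a,b\in\mathbb R$ satisfy $a,b>-1$ and $a+b<-1$, and let $c=1$. Then the following hold. (i) $S_{a,b,1}$ is unbounded from $L^{\frac{1}{b+1},1}(\mathbb D)$ to $L^{-\frac1a,\infty}(\mathbb D)$. (ii) $T_{a,b,1}$ is bounded from $L^{\frac{1}{b+1},1}(\mathbb D)$ to $L^{-\frac1a,\infty}(\mathbb D)$.
   Context: $\mathbb D$ is the open unit disc in $\mathbb C$, $dA$ is normalized area measure on $\mathbb D$, and $|E|$ is the $dA$-measure of $E\subseteq\mathbb D$. For $a,b,c\in\mathbb R$, $$T_{a,b,c}f(z):=(1-|z|^2)^a\int_{\mathbb D}\frac{(1-|w|^2)^b}{(1-z\overline w)^c}f(w)\,dA(w),\qquad S_{a,b,c}f(z):=(1-|z|^2)^a\int_{\mathbb D}\frac{(1-|w|^2)^b}{|1-z\overline w|^c}f(w)\,dA(w),$$ with the principal branch of the power. For $1\le q<\infty$, $\|f\|_{L^{q,\infty}}=\sup_{\lambda>0}\lambda|\{|f|>\lambda\}|^{1/q}$; for $1\le p<\infty$, $\|f\|_{L^{p,1}}=p\int_0^\infty|\{|f|>\lambda\}|^{1/p}\,d\lambda$. An operator $\mathcal T$ is bounded from $X$ to $Y$ if for every $f\in X$ the defining integral converges absolutely for a.e. $z$ and $\|\mathcal Tf\|_Y\le C\|f\|_X$ with $C$ independent of $f$; otherwise it is unbounded from $X$ to $Y$. *)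

theory Defs
  imports "HOL-Analysis.Analysis"
begin

definition disc_area :: "complex measure" where
  "disc_area = density (lebesgue_on (ball 0 1)) (\<lambda>_. ennreal (1 / pi))"

definition superlevel :: "(complex \<Rightarrow> complex) \<Rightarrow> real \<Rightarrow> complex set" where
  "superlevel f t = {z \<in> space disc_area. t < norm (f z)}"

text \<open>
  The Lorentz quasi-norms take the value \<open>\<infinity>\<close>. The \<open>disc_area\<close> measure of a set is at most \<open>1\<close>, so
  the real-valued \<^const>\<open>measure\<close> and the real power can be used inside them.
  They are meaningful for measurable functions only, see \<open>function_space\<close>.
\<close>

definition weak_norm :: "real \<Rightarrow> (complex \<Rightarrow> complex) \<Rightarrow> ennreal" where
  "weak_norm q f = (SUP t\<in>{0<..}. ennreal (t * measure disc_area (superlevel f t) powr (1 / q)))"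

definition lorentz1_norm :: "real \<Rightarrow> (complex \<Rightarrow> complex) \<Rightarrow> ennreal" where
  "lorentz1_norm p f =
     ennreal p * (\<integral>\<^sup>+t\<in>{0<..}. ennreal (measure disc_area (superlevel f t) powr (1 / p)) \<partial>lborel)"

definition function_space :: "((complex \<Rightarrow> complex) \<Rightarrow> ennreal) \<Rightarrow> (complex \<Rightarrow> complex) set" where
  "function_space N = {f \<in> borel_measurable disc_area. N f < \<infinity>}"

definition T_kernel :: "real \<Rightarrow> real \<Rightarrow> complex \<Rightarrow> complex \<Rightarrow> complex" where
  "T_kernel b c z w =
     complex_of_real ((1 - (norm w)\<^sup>2) powr b) / (1 - z * cnj w) powr complex_of_real c"

definition S_kernel :: "real \<Rightarrow> real \<Rightarrow> complex \<Rightarrow> complex \<Rightarrow> complex" where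
  "S_kernel b c z w =
     complex_of_real ((1 - (norm w)\<^sup>2) powr b / norm (1 - z * cnj w) powr c)"

definition weighted_op ::
    "real \<Rightarrow> (complex \<Rightarrow> complex \<Rightarrow> complex) \<Rightarrow> (complex \<Rightarrow> complex) \<Rightarrow> complex \<Rightarrow> complex" where
  "weighted_op a K f z =
     complex_of_real ((1 - (norm z)\<^sup>2) powr a) * (LINT w|disc_area. K z w * f w)"

text \<open>
  The Bochner integral is \<open>0\<close> where the defining integral diverges, so absolute convergence for
  almost every \<open>z\<close> is required separately.
\<close>

definition weighted_op_bounded ::
    "real \<Rightarrow> (complex \<Rightarrow> complex \<Rightarrow> complex) \<Rightarrow>
     ((complex \<Rightarrow> complex) \<Rightarrow> ennreal) \<Rightarrow> ((complex \<Rightarrow> complex) \<Rightarrow> ennreal) \<Rightarrow> bool" where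
  "weighted_op_bounded a K NX NY \<longleftrightarrow>
     (\<exists>C\<ge>0. \<forall>f\<in>function_space NX.
        (AE z in disc_area. integrable disc_area (\<lambda>w. K z w * f w)) \<and>
        weighted_op a K f \<in> function_space NY \<and>
        NY (weighted_op a K f) \<le> ennreal C * NX f)"

definition T_bounded ::
    "real \<Rightarrow> real \<Rightarrow> real \<Rightarrow>
     ((complex \<Rightarrow> complex) \<Rightarrow> ennreal) \<Rightarrow> ((complex \<Rightarrow> complex) \<Rightarrow> ennreal) \<Rightarrow> bool" where
  "T_bounded a b c = weighted_op_bounded a (T_kernel b c)"

definition S_bounded ::
    "real \<Rightarrow> real \<Rightarrow> real \<Rightarrow>
     ((complex \<Rightarrow> complex) \<Rightarrow> ennreal) \<Rightarrow> ((complex \<Rightarrow> complex) \<Rightarrow> ennreal) \<Rightarrow> bool" where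
  "S_bounded a b c = weighted_op_bounded a (S_kernel b c)"

end

theory Submission
  imports Defs "HOL-Complex_Analysis.Complex_Analysis"
begin

text \<open>
  Put \<open>p = 1 / (b + 1)\<close> and \<open>q = - 1 / a\<close>, so that \<open>1 < q < p\<close>, and test \<open>S\<close> on the annuli
  \<open>1 - \<bar>w\<bar>\<^sup>2 \<le> \<delta>\<close>: averaging \<open>1 / \<bar>1 - z cnj w\<bar>\<close> over rotations of \<open>w\<close> produces a factor
  \<open>ln (1 / \<delta>)\<close>, which is unbounded.

  For \<open>T\<close> the cancellation enters through the theorem of M. Riesz at an exponent \<open>r\<close> with
  \<open>q < r < p\<close>. For nonnegative \<open>f\<close> let \<open>H\<close> be the Cauchy transform of \<open>(1 - \<bar>w\<bar>\<^sup>2)\<^sup>b f\<close> and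
  \<open>F = 2 H - H 0\<close>. The real part of \<open>F\<close> is a Poisson integral, and its \<open>r\<close>-means over circles are
  bounded by the Lorentz norm of \<open>f\<close> because \<open>r < p\<close>. If \<open>r\<close> is not an odd integer, then
  \<open>\<bar>F\<bar>\<^sup>r \<le> A (Re F)\<^sup>r + B Re (F\<^sup>r)\<close> on the right half plane, and the mean value property for
  \<open>F\<^sup>r\<close> bounds the means of \<open>\<bar>F\<bar>\<^sup>r\<close>. Since these bounds are uniform in the radius and \<open>r > q\<close>,
  Chebyshev's inequality away from the boundary gives the weak-type estimate without any maximal
  function.
\<close>

subsection \<open>Rotations, the disc and the circle\<close>

text \<open>The powers balance exactly: an annulus of area \<open>\<delta>\<close> has source norm
  and weighted mass both of order \<open>\<delta> powr (b + 1)\<close>, while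
  \<open>defect z powr a\<close> has target norm of order one. No power of \<open>\<delta>\<close>
  is left to absorb a logarithm, so bounding the kernel of \<open>T\<close> by its modulus must
  fail. The hypothesis \<open>a + b < -1\<close> says exactly that \<open>q < p\<close>. With
  \<open>k\<close> the exponent conjugate to \<open>r\<close>, the condition \<open>r < p\<close>
  reads \<open>b * k < -1\<close> and \<open>r > q\<close> reads \<open>a * r < -1\<close>. These
  are the two conditions under which the integral of a power of the defect beyond a cut
  \<open>m\<close> is controlled by the power of \<open>m\<close> alone; the first serves duality,
  the second Chebyshev. The combination \<open>F\<close> comes from
  \<open>2 / (1 - u) - 1 = (1 + u) / (1 - u)\<close>, whose real part is the Poisson kernel;
  positivity keeps \<open>F\<close> off the branch cut, so that its power is holomorphic. For odd
  \<open>r\<close> the real part of that power vanishes on the imaginary axis and cannot control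
  \<open>F\<close> where \<open>Re F\<close> is small.\<close>

lemma sets_ball_borel [measurable]: "ball (0 :: complex) 1 \<in> sets borel"
  by simp

lemma nn_integral_lborel_shift:
  fixes f :: "complex \<Rightarrow> ennreal"
  assumes [measurable]: "f \<in> borel_measurable borel"
  shows "(\<integral>\<^sup>+x. f (c + x) \<partial>lborel) = (\<integral>\<^sup>+x. f x \<partial>lborel)"
proof -
  have "(\<integral>\<^sup>+x. f x \<partial>lborel) = (\<integral>\<^sup>+x. f x \<partial>(distr lborel borel ((+) c)))"
    by (simp add: lborel_distr_plus)
  then show ?thesis
    by (simp add: nn_integral_distr)
qed

lemma nn_integral_lborel_reflect:
  fixes f :: "complex \<Rightarrow> ennreal"
  assumes [measurable]: "f \<in> borel_measurable borel"
  shows "(\<integral>\<^sup>+x. f (c - x) \<partial>lborel) = (\<integral>\<^sup>+x. f x \<partial>lborel)"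
proof -
  have "(lborel :: complex measure) = distr lborel borel (\<lambda>x. c - x)"
    using lborel_affine[of "-1" c] by (simp add: density_1)
  then have "(\<integral>\<^sup>+x. f x \<partial>lborel) = (\<integral>\<^sup>+x. f x \<partial>distr lborel borel (\<lambda>x. c - x))"
    by simp
  then show ?thesis
    by (simp add: nn_integral_distr)
qed

text \<open>
  Uniqueness of translation invariant measures: the convolution of \<open>f (c * x)\<close> with the indicator of
  a disc is evaluated in two orders, and the disc is rotation invariant.
\<close>

lemma nn_integral_lborel_rotate:
  fixes f :: "complex \<Rightarrow> ennreal"
  assumes [measurable]: "f \<in> borel_measurable borel" and c: "norm c = 1"
  shows "(\<integral>\<^sup>+x. f (c * x) \<partial>lborel) = (\<integral>\<^sup>+x. f x \<partial>lborel)"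
proof -
  let ?B = "indicator (ball 0 1) :: complex \<Rightarrow> ennreal"
  let ?k = "emeasure lborel (ball (0::complex) 1)"
  have c0: "c \<noteq> 0" using c by auto
  have k: "(\<integral>\<^sup>+y. ?B y \<partial>lborel) = ?k" by simp
  have "?k * (\<integral>\<^sup>+x. f (c * x) \<partial>lborel) = (\<integral>\<^sup>+y. ?B y * (\<integral>\<^sup>+x. f (c * x) \<partial>lborel) \<partial>lborel)"
    by (subst nn_integral_multc) (auto simp: k)
  also have "\<dots> = (\<integral>\<^sup>+y. (\<integral>\<^sup>+x. ?B y * f (c * x + y) \<partial>lborel) \<partial>lborel)"
  proof (rule nn_integral_cong)
    fix y
    have "(\<integral>\<^sup>+x. f (c * (y / c + x)) \<partial>lborel) = (\<integral>\<^sup>+x. f (c * x) \<partial>lborel)"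
      by (rule nn_integral_lborel_shift) measurable
    then show "?B y * (\<integral>\<^sup>+x. f (c * x) \<partial>lborel) = (\<integral>\<^sup>+x. ?B y * f (c * x + y) \<partial>lborel)"
      using c0 by (simp add: nn_integral_cmult algebra_simps)
  qed
  also have "\<dots> = (\<integral>\<^sup>+x. (\<integral>\<^sup>+y. ?B y * f (c * x + y) \<partial>lborel) \<partial>lborel)"
    by (rule lborel_pair.Fubini') measurable
  also have "\<dots> = (\<integral>\<^sup>+x. (\<integral>\<^sup>+y. ?B (y - c * x) * f y \<partial>lborel) \<partial>lborel)"
  proof (rule nn_integral_cong)
    fix x
    have "(\<integral>\<^sup>+y. ?B ((c * x + y) - c * x) * f (c * x + y) \<partial>lborel) = (\<integral>\<^sup>+y. ?B (y - c * x) * f y \<partial>lborel)"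
      by (rule nn_integral_lborel_shift) measurable
    then show "(\<integral>\<^sup>+y. ?B y * f (c * x + y) \<partial>lborel) = (\<integral>\<^sup>+y. ?B (y - c * x) * f y \<partial>lborel)"
      by simp
  qed
  also have "\<dots> = (\<integral>\<^sup>+y. (\<integral>\<^sup>+x. ?B (y - c * x) * f y \<partial>lborel) \<partial>lborel)"
    by (rule lborel_pair.Fubini') measurable
  also have "\<dots> = (\<integral>\<^sup>+y. ?k * f y \<partial>lborel)"
  proof (rule nn_integral_cong)
    fix y
    have eq: "?B (y - c * x) = ?B (y / c - x)" for x
    proof -
      have "y - c * x = c * (y / c - x)" using c0 by (simp add: field_simps)
      then have "norm (y - c * x) = norm (y / c - x)" by (simp only: norm_mult c mult_1_left)
      then show ?thesis by (simp add: indicator_def)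
    qed
    have "(\<integral>\<^sup>+x. ?B (y - c * x) \<partial>lborel) = ?k"
      unfolding eq by (subst nn_integral_lborel_reflect) auto
    then show "(\<integral>\<^sup>+x. ?B (y - c * x) * f y \<partial>lborel) = ?k * f y"
      by (simp add: nn_integral_multc)
  qed
  also have "\<dots> = ?k * (\<integral>\<^sup>+y. f y \<partial>lborel)"
    by (simp add: nn_integral_cmult)
  finally have "?k * (\<integral>\<^sup>+x. f (c * x) \<partial>lborel) = ?k * (\<integral>\<^sup>+y. f y \<partial>lborel)" .
  moreover have "?k \<noteq> 0" "?k \<noteq> \<infinity>"
    by (simp_all add: emeasure_ball eval_unit_ball_vol)
  ultimately show ?thesis
    by (metis ennreal_mult_cancel_left infinity_ennreal_def)
qed

lemma space_disc_area [simp]: "space disc_area = ball 0 1"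
  by (simp add: disc_area_def)

text \<open>\<open>disc_area\<close> lives on the Lebesgue sets, and the functions \<open>f\<close>
  acted upon are only Lebesgue measurable. Kernels and weights are Borel and enter through this
  inclusion.\<close>

lemma borel_measurable_disc_area:
  assumes "f \<in> measurable borel M"
  shows "f \<in> measurable disc_area M"
proof -
  have "f \<in> measurable lebesgue M"
    by (intro measurable_completion) (simp add: assms)
  then show ?thesis
    by (simp add: disc_area_def measurable_restrict_space1)
qed

lemma ident_measurable_disc_area: "(\<lambda>w. w) \<in> disc_area \<rightarrow>\<^sub>M borel"
  by (rule borel_measurable_disc_area) simp

lemma nn_integral_disc_area:
  assumes [measurable]: "f \<in> borel_measurable borel"
  shows "(\<integral>\<^sup>+w. f w \<partial>disc_area) = ennreal (1 / pi) * (\<integral>\<^sup>+w. f w * indicator (ball 0 1) w \<partial>lborel)"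
proof -
  have m: "f \<in> borel_measurable (lebesgue_on (ball 0 1))"
    using borel_measurable_disc_area[OF assms] by (simp add: disc_area_def)
  have "(\<integral>\<^sup>+w. f w \<partial>disc_area) = ennreal (1 / pi) * (\<integral>\<^sup>+w. f w \<partial>lebesgue_on (ball 0 1))"
    unfolding disc_area_def using m by (simp add: nn_integral_density nn_integral_cmult)
  also have "(\<integral>\<^sup>+w. f w \<partial>lebesgue_on (ball 0 1)) = (\<integral>\<^sup>+w. f w * indicator (ball 0 1) w \<partial>lebesgue)"
    by (simp add: nn_integral_restrict_space)
  also have "\<dots> = (\<integral>\<^sup>+w. f w * indicator (ball 0 1) w \<partial>lborel)"
    by (simp add: nn_integral_completion)
  finally show ?thesis .
qed

lemma nn_integral_disc_area_rotate:
  assumes [measurable]: "f \<in> borel_measurable borel" and c: "norm c = 1"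
  shows "(\<integral>\<^sup>+w. f (c * w) \<partial>disc_area) = (\<integral>\<^sup>+w. f w \<partial>disc_area)"
proof -
  have eq: "indicator (ball 0 1) (c * w) = (indicator (ball 0 1) w :: ennreal)" for w
    using c by (simp add: indicator_def norm_mult)
  have "(\<integral>\<^sup>+w. f (c * w) * indicator (ball 0 1) (c * w) \<partial>lborel) = (\<integral>\<^sup>+w. f w * indicator (ball 0 1) w \<partial>lborel)"
    by (rule nn_integral_lborel_rotate[OF _ c]) measurable
  then show ?thesis
    by (simp add: nn_integral_disc_area eq)
qed

section \<open>The distribution of the defect under area measure\<close>

definition defect :: "complex \<Rightarrow> real" where
  "defect w = 1 - (norm w)\<^sup>2"

lemma borel_measurable_defect [measurable]: "defect \<in> borel_measurable borel"
  unfolding defect_def[abs_def] by measurable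

lemma defect_pos: "norm w < 1 \<Longrightarrow> 0 < defect w"
  by (simp add: defect_def abs_square_less_1)

lemma defect_le_1: "defect w \<le> 1"
  by (simp add: defect_def)

text \<open>The points with defect above \<open>x\<close> form a concentric disc of squared radius
  \<open>1 - x\<close>, hence of normalized area \<open>1 - x\<close>. So the defect is uniformly
  distributed, and radial integrals become one-dimensional ones without a Jacobian.\<close>

lemma distr_defect:
  "distr disc_area borel defect = density lborel (indicator {0<..1})"
proof (rule measure_eqI_lessThan)
  have m: "defect \<in> disc_area \<rightarrow>\<^sub>M borel"
    by (rule borel_measurable_disc_area) measurable
  have dens: "emeasure (density lborel (indicator {0<..1})) {x<..} = emeasure lborel ({0<..1} \<inter> {x<..})" for x :: real
    by (simp add: emeasure_density indicator_inter_arith[symmetric])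
  have dist: "emeasure (distr disc_area borel defect) {x<..} =
      ennreal (1 / pi) * emeasure lborel ({w. x < defect w} \<inter> ball 0 1)" for x :: real
  proof -
    have "emeasure (distr disc_area borel defect) {x<..} = (\<integral>\<^sup>+y. indicator {x<..} y \<partial>distr disc_area borel defect)"
      by simp
    also have "\<dots> = (\<integral>\<^sup>+w. indicator {x<..} (defect w) \<partial>disc_area)"
      by (rule nn_integral_distr[OF m]) simp
    also have "\<dots> = (\<integral>\<^sup>+w. indicator {w. x < defect w} w \<partial>disc_area)"
      by (simp add: indicator_def)
    also have "\<dots> = ennreal (1 / pi) * emeasure lborel ({w. x < defect w} \<inter> ball 0 1)"
      by (subst nn_integral_disc_area) (auto simp: indicator_inter_arith[symmetric])
    finally show ?thesis .
  qed
  fix x :: real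
  \<comment> \<open>The \<open>max\<close> covers negative \<open>x\<close>, where the set is the
    whole disc.\<close>
  have eq: "{w. x < defect w} \<inter> ball 0 1 = ball 0 (sqrt (1 - max 0 x))" if "x < 1"
  proof (rule set_eqI)
    fix w :: complex
    have "norm w < sqrt (1 - max 0 x) \<longleftrightarrow> (norm w)\<^sup>2 < 1 - max 0 x"
      using that by (metis norm_ge_zero real_less_rsqrt real_sqrt_less_iff real_sqrt_unique)
    moreover have "norm w < 1 \<longleftrightarrow> (norm w)\<^sup>2 < 1"
      using abs_square_less_1 by force
    ultimately show "w \<in> {w. x < defect w} \<inter> ball 0 1 \<longleftrightarrow> w \<in> ball 0 (sqrt (1 - max 0 x))"
      by (auto simp: defect_def)
  qed
  show "emeasure (distr disc_area borel defect) {x<..} = emeasure (density lborel (indicator {0<..1})) {x<..}"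
  proof (cases "x < 1")
    case True
    have "{0<..1} \<inter> {x<..} = {max 0 x<..1}" by auto
    with True show ?thesis
      unfolding dist dens eq[OF True]
      by (simp add: emeasure_ball eval_unit_ball_vol ennreal_mult'[symmetric])
  next
    case False
    then have "{0<..1} \<inter> {x<..} = {}" by auto
    moreover have "{w. x < defect w} = {}"
      using False defect_le_1 by (metis (mono_tags, lifting) dual_order.strict_trans1 empty_Collect_eq)
    ultimately
    show ?thesis
      unfolding dist dens by simp
  qed
  show "emeasure (distr disc_area borel defect) {x<..} < \<infinity>"
  proof -
    have "emeasure lborel ({w. x < defect w} \<inter> ball 0 1) \<le> emeasure lborel (ball (0::complex) 1)"
      by (rule emeasure_mono) auto
    also have "\<dots> < \<infinity>" by (simp add: emeasure_ball)
    finally show ?thesis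
      unfolding dist by (simp add: ennreal_mult_less_top)
  qed
qed auto

lemma nn_integral_defect:
  assumes [measurable]: "f \<in> borel_measurable borel"
  shows "(\<integral>\<^sup>+w. f (defect w) \<partial>disc_area) = (\<integral>\<^sup>+x. f x * indicator {0<..1} x \<partial>lborel)"
proof -
  have m: "defect \<in> disc_area \<rightarrow>\<^sub>M borel"
    by (rule borel_measurable_disc_area) measurable
  have "(\<integral>\<^sup>+w. f (defect w) \<partial>disc_area) = (\<integral>\<^sup>+x. f x \<partial>distr disc_area borel defect)"
    by (simp add: nn_integral_distr[OF m])
  then show ?thesis
    unfolding distr_defect by (simp add: nn_integral_density mult.commute)
qed

lemma emeasure_space_disc_area: "emeasure disc_area (ball 0 1) = 1"
proof -
  have "emeasure disc_area (ball 0 1) = (\<integral>\<^sup>+w. 1 \<partial>disc_area)"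
    by (subst nn_integral_const) simp
  also have "\<dots> = 1"
    by (subst nn_integral_defect[of "\<lambda>_. 1"]) simp_all
  finally show ?thesis .
qed

interpretation disc: finite_measure disc_area
  by standard (simp add: emeasure_space_disc_area)

text \<open>Normalized arc length, realised as a Borel measure on the whole plane so that products
  with \<open>disc_area\<close> need no subspaces. The price is that \<open>norm \<zeta> = 1\<close>
  holds only almost everywhere.\<close>

definition circle_measure :: "complex measure" where
  "circle_measure = distr (density lborel (indicator {0..1})) borel (\<lambda>t. exp (2 * pi * t * \<i>))"

lemma sets_circle_measure [simp, measurable_cong]: "sets circle_measure = sets borel"
  by (simp add: circle_measure_def)

lemma space_circle_measure [simp]: "space circle_measure = UNIV"
  by (simp add: circle_measure_def)

lemma nn_integral_circle_measure:
  assumes [measurable]: "f \<in> borel_measurable borel"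
  shows "(\<integral>\<^sup>+\<zeta>. f \<zeta> \<partial>circle_measure) = (\<integral>\<^sup>+t. f (exp (2 * pi * t * \<i>)) * indicator {0..1} t \<partial>lborel)"
  unfolding circle_measure_def by (simp add: nn_integral_distr nn_integral_density mult.commute)

lemma emeasure_space_circle_measure: "emeasure circle_measure UNIV = 1"
proof -
  have "emeasure circle_measure UNIV = (\<integral>\<^sup>+\<zeta>. 1 \<partial>circle_measure)"
    by simp
  also have "\<dots> = 1"
    by (subst nn_integral_circle_measure) simp_all
  finally show ?thesis .
qed

interpretation circle: finite_measure circle_measure
  by standard (simp add: emeasure_space_circle_measure)

interpretation disc_circle: pair_sigma_finite disc_area circle_measure ..

lemma AE_circle_measure: "AE \<zeta> in circle_measure. norm \<zeta> = 1"
  unfolding circle_measure_def by (subst AE_distr_iff) auto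

lemma measurable_disc_circle:
  assumes "f \<in> measurable (borel \<Otimes>\<^sub>M borel) M"
  shows "f \<in> measurable (disc_area \<Otimes>\<^sub>M circle_measure) M"
proof -
  have "(\<lambda>x. (fst x, snd x)) \<in> (disc_area \<Otimes>\<^sub>M circle_measure) \<rightarrow>\<^sub>M (borel \<Otimes>\<^sub>M borel)"
    by (intro measurable_Pair measurable_compose[OF measurable_fst ident_measurable_disc_area]) simp_all
  from measurable_compose[OF this assms] show ?thesis by simp
qed

lemma disc_circle_Fubini:
  assumes "(\<lambda>(w, \<zeta>). f w \<zeta>) \<in> borel_measurable (disc_area \<Otimes>\<^sub>M circle_measure)"
  shows "(\<integral>\<^sup>+w. \<integral>\<^sup>+\<zeta>. f w \<zeta> \<partial>circle_measure \<partial>disc_area) =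
         (\<integral>\<^sup>+\<zeta>. \<integral>\<^sup>+w. f w \<zeta> \<partial>disc_area \<partial>circle_measure)"
  using disc_circle.Fubini'[OF assms] by simp

text \<open>
  This replaces polar coordinates: only the rotation invariance of the area is used.
\<close>

lemma nn_integral_disc_area_polar:
  assumes [measurable]: "f \<in> borel_measurable borel"
  shows "(\<integral>\<^sup>+w. f w \<partial>disc_area) = (\<integral>\<^sup>+w. \<integral>\<^sup>+\<zeta>. f (w * \<zeta>) \<partial>circle_measure \<partial>disc_area)"
proof -
  have "(\<integral>\<^sup>+w. \<integral>\<^sup>+\<zeta>. f (w * \<zeta>) \<partial>circle_measure \<partial>disc_area) =
        (\<integral>\<^sup>+\<zeta>. \<integral>\<^sup>+w. f (w * \<zeta>) \<partial>disc_area \<partial>circle_measure)"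
    by (intro disc_circle_Fubini measurable_disc_circle) measurable
  also have "\<dots> = (\<integral>\<^sup>+\<zeta>. \<integral>\<^sup>+w. f w \<partial>disc_area \<partial>circle_measure)"
    by (intro nn_integral_cong_AE, use AE_circle_measure in eventually_elim)
       (use nn_integral_disc_area_rotate[OF assms] in \<open>simp add: mult.commute\<close>)
  also have "\<dots> = (\<integral>\<^sup>+w. f w \<partial>disc_area)"
    by (simp add: emeasure_space_circle_measure)
  finally show ?thesis by simp
qed

text \<open>Cauchy's formula at the centre. Holomorphy beyond the unit circle avoids boundary
  limits; global Borel measurability is required because \<open>G\<close> may be arbitrary away from
  the ball while \<open>circle_measure\<close> lives on the plane.\<close>

lemma circle_measure_mean_value:
  assumes G: "G holomorphic_on ball 0 R" and R: "1 < R"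
    and [measurable]: "G \<in> borel_measurable borel"
  shows "has_bochner_integral circle_measure G (G 0)"
proof -
  have cont: "continuous_on (cball 0 1) G"
    by (rule continuous_on_subset[OF holomorphic_on_imp_continuous_on[OF G]]) (use R in auto)
  have hol: "G holomorphic_on cball 0 1"
    by (rule holomorphic_on_subset[OF G]) (use R in auto)
  have path: "continuous_on {0..1} (\<lambda>t::real. G (exp (2 * pi * t * \<i>)))"
    by (rule continuous_on_compose2[OF cont]) (auto intro!: continuous_intros)
  have "((\<lambda>u. G u / (u - 0)) has_contour_integral (2 * of_real pi * \<i> * G 0)) (circlepath 0 1)"
    by (rule Cauchy_integral_circlepath_simple[OF hol]) simp
  then have "((\<lambda>t::real. 2 * pi * \<i> * G (exp (2 * pi * t * \<i>))) has_integral (2 * of_real pi * \<i> * G 0)) {0..1}"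
    unfolding has_contour_integral vector_derivative_circlepath
    by (rule has_integral_eq[rotated]) (simp add: circlepath mult_ac)
  then have "((\<lambda>t::real. G (exp (2 * pi * t * \<i>))) has_integral G 0) {0..1}"
    by (drule_tac has_integral_mult_right[where c = "1 / (2 * pi * \<i>)"]) simp
  moreover have int: "set_integrable lborel {0..1} (\<lambda>t::real. G (exp (2 * pi * t * \<i>)))"
    by (rule borel_integrable_atLeastAtMost') (rule path)
  ultimately have val: "(LBINT t:{0..1}. G (exp (2 * pi * t * \<i>))) = G 0"
    using set_borel_integral_eq_integral(2)[OF int] integral_unique by metis
  have "has_bochner_integral lborel (\<lambda>t. indicator {0..1} t *\<^sub>R G (exp (2 * pi * t * \<i>))) (G 0)"
    using int val by (simp add: has_bochner_integral_iff set_integrable_def set_lebesgue_integral_def)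
  then have "has_bochner_integral (density lborel (\<lambda>t. ennreal (indicator {0..1} t))) (\<lambda>t. G (exp (2 * pi * t * \<i>))) (G 0)"
    by (intro has_bochner_integral_density) auto
  then show ?thesis
    unfolding circle_measure_def
    by (intro has_bochner_integral_distr) (auto simp: ennreal_indicator)
qed

subsection \<open>Radial weights and the Poisson kernel\<close>

lemma defect_mult_circle: "norm \<zeta> = 1 \<Longrightarrow> defect (w * \<zeta>) = defect w"
  by (simp add: defect_def norm_mult)

text \<open>The bound is the integral of \<open>x powr b\<close> from 0 to \<open>m\<close>.
  Forgetting that the defect stops at 1 makes it valid for every \<open>m\<close>; the companion
  bound beyond \<open>m\<close> extends the integral to infinity in the same way.\<close>

lemma nn_integral_defect_near:
  assumes "-1 < b" "0 \<le> m"
  shows "(\<integral>\<^sup>+w. ennreal (defect w powr b) * indicator {0..m} (defect w) \<partial>disc_area) \<le> ennreal (m powr (b + 1) / (b + 1))"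
proof -
  have "(\<integral>\<^sup>+w. ennreal (defect w powr b) * indicator {0..m} (defect w) \<partial>disc_area)
      = (\<integral>\<^sup>+x. (ennreal (x powr b) * indicator {0..m} x) * indicator {0<..1} x \<partial>lborel)"
    by (rule nn_integral_defect) measurable
  also have "\<dots> \<le> (\<integral>\<^sup>+x. ennreal (x powr b) * indicator {0..m} x \<partial>lborel)"
    by (intro nn_integral_mono) (auto split: split_indicator)
  also have "\<dots> = ennreal (m powr (b + 1) / (b + 1))"
    using assms by (intro nn_integral_has_integral_lebesgue' has_integral_powr_from_0) auto
  finally show ?thesis .
qed

lemma nn_integral_defect_far:
  assumes "k < -1" "0 < m"
  shows "(\<integral>\<^sup>+w. ennreal (defect w powr k) * indicator {m..} (defect w) \<partial>disc_area) \<le> ennreal (m powr (k + 1) / (- k - 1))"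
proof -
  have "(\<integral>\<^sup>+w. ennreal (defect w powr k) * indicator {m..} (defect w) \<partial>disc_area)
      = (\<integral>\<^sup>+x. (ennreal (x powr k) * indicator {m..} x) * indicator {0<..1} x \<partial>lborel)"
    by (rule nn_integral_defect) measurable
  also have "\<dots> \<le> (\<integral>\<^sup>+x. ennreal (x powr k) * indicator {m..} x \<partial>lborel)"
    by (intro nn_integral_mono) (auto split: split_indicator)
  also have "\<dots> = ennreal (- (m powr (k + 1)) / (k + 1))"
    using assms by (intro nn_integral_has_integral_lebesgue' has_integral_powr_to_inf) auto
  also have "- (m powr (k + 1)) / (k + 1) = m powr (k + 1) / (- k - 1)"
    using assms by (simp add: field_simps)
  finally show ?thesis .
qed

lemma borel_measurable_cnj [measurable]: "cnj \<in> borel_measurable borel"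
  by (intro borel_measurable_continuous_onI continuous_intros)

section \<open>The Poisson kernel and its means\<close>

definition poisson :: "complex \<Rightarrow> real" where
  "poisson u = Re ((1 + u) / (1 - u))"

lemma borel_measurable_poisson [measurable]: "poisson \<in> borel_measurable borel"
  unfolding poisson_def[abs_def] by measurable

lemma one_minus_nonzero: "norm u < 1 \<Longrightarrow> 1 - u \<noteq> (0 :: complex)"
  by (metis eq_iff_diff_eq_0 less_irrefl norm_one)

lemma poisson_eq: "norm u < 1 \<Longrightarrow> poisson u = (1 - (norm u)\<^sup>2) / (norm (1 - u))\<^sup>2"
  unfolding poisson_def cmod_power2
  by (simp add: Re_divide power2_eq_square algebra_simps)

lemma poisson_cnj: "poisson (cnj u) = poisson u"
proof -
  have "(1 + cnj u) / (1 - cnj u) = cnj ((1 + u) / (1 - u))" by simp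
  then show ?thesis unfolding poisson_def by (simp only: cnj.sel)
qed

text \<open>A Harnack bound: the kernel is smallest where \<open>norm (1 - u)\<close> is largest,
  namely \<open>1 + norm u\<close>. It is what makes the real part of \<open>F\<close> strictly
  positive later.\<close>

lemma poisson_lower:
  assumes "norm u < 1"
  shows "(1 - norm u) / 2 \<le> poisson u"
proof -
  have n: "0 < norm (1 - u)" using one_minus_nonzero[OF assms] by simp
  have "norm (1 - u) \<le> 1 + norm u"
    using norm_triangle_ineq4[of 1 u] by simp
  then have "(norm (1 - u))\<^sup>2 \<le> (1 + norm u)\<^sup>2"
    by (intro power_mono) auto
  then have "(1 - (norm u)\<^sup>2) / (1 + norm u)\<^sup>2 \<le> (1 - (norm u)\<^sup>2) / (norm (1 - u))\<^sup>2"
    using assms n by (intro divide_left_mono) (auto simp: abs_square_le_1 intro!: mult_pos_pos zero_less_power add_pos_nonneg)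
  moreover have "(1 - (norm u)\<^sup>2) / (1 + norm u)\<^sup>2 = (1 - norm u) / (1 + norm u)"
  proof -
    have "1 + norm u \<noteq> 0" using norm_ge_zero[of u] by linarith
    then show ?thesis by (simp add: power2_eq_square divide_simps) (simp add: algebra_simps)
  qed
  moreover have "(1 - norm u) / 2 \<le> (1 - norm u) / (1 + norm u)"
    using assms by (intro divide_left_mono) (auto simp: add_pos_nonneg)
  ultimately show ?thesis
    using poisson_eq[OF assms] by linarith
qed

lemma poisson_nonneg: "norm u < 1 \<Longrightarrow> 0 \<le> poisson u"
  using poisson_lower[of u] by simp

lemma norm_one_minus_ge: "1 - norm u \<le> norm (1 - u :: complex)"
  using norm_triangle_ineq2[of 1 u] by simp

text \<open>Crude, and used only to make Poisson integrals finite on a fixed circle; no quantitative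
  constant depends on it.\<close>

lemma poisson_upper:
  assumes "norm u < 1"
  shows "poisson u \<le> 2 / (1 - norm u)"
proof -
  have "poisson u \<le> norm (1 + u) / norm (1 - u)"
    unfolding poisson_def norm_divide[symmetric] by (rule complex_Re_le_cmod)
  also have "\<dots> \<le> 2 / (1 - norm u)"
    using assms norm_triangle_ineq[of 1 u] norm_one_minus_ge[of u] by (intro frac_le) auto
  finally show ?thesis .
qed

lemma poisson_mean:
  assumes "norm u < 1"
  shows "(\<integral>\<^sup>+\<zeta>. ennreal (poisson (u * \<zeta>)) \<partial>circle_measure) = 1"
proof -
  \<comment> \<open>The radius of holomorphy in \<zeta>, which exceeds 1. The case
    \<open>u = 0\<close> is separate because \<open>1 / 0 = 0\<close>.\<close>
  define R where "R = (if u = 0 then 2 else 1 / norm u)"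
  have R: "1 < R" using assms by (auto simp: R_def)
  have lt: "norm (u * \<zeta>) < 1" if "norm \<zeta> < R" for \<zeta>
    using that by (auto simp: R_def norm_mult field_simps split: if_splits)
  have "(\<lambda>\<zeta>. (1 + u * \<zeta>) / (1 - u * \<zeta>)) holomorphic_on ball 0 R"
    using one_minus_nonzero[OF lt] by (intro holomorphic_intros) auto
  from circle_measure_mean_value[OF this R]
  have "has_bochner_integral circle_measure (\<lambda>\<zeta>. (1 + u * \<zeta>) / (1 - u * \<zeta>)) 1"
    by simp
  from has_bochner_integral_Re[OF this]
  have "has_bochner_integral circle_measure (\<lambda>\<zeta>. poisson (u * \<zeta>)) 1"
    by (simp add: poisson_def)
  moreover have "AE \<zeta> in circle_measure. 0 \<le> poisson (u * \<zeta>)"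
    using AE_circle_measure by eventually_elim (auto intro!: poisson_nonneg lt R)
  ultimately show ?thesis
    by (simp add: has_bochner_integral_iff nn_integral_eq_integral)
qed

text \<open>Rotating \<open>w\<close> leaves a radial weight unchanged, and the mean of the kernel
  over these rotations is 1 by \<open>poisson_mean\<close>.\<close>

lemma poisson_radial_mean:
  assumes [measurable]: "\<omega> \<in> borel_measurable borel" and v: "norm v < 1"
  shows "(\<integral>\<^sup>+w. \<omega> (defect w) * ennreal (poisson (v * cnj w)) \<partial>disc_area) = (\<integral>\<^sup>+w. \<omega> (defect w) \<partial>disc_area)"
proof -
  have "(\<integral>\<^sup>+w. \<omega> (defect w) * ennreal (poisson (v * cnj w)) \<partial>disc_area) =
    (\<integral>\<^sup>+w. \<integral>\<^sup>+\<zeta>. \<omega> (defect (w * \<zeta>)) * ennreal (poisson (v * cnj (w * \<zeta>))) \<partial>circle_measure \<partial>disc_area)"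
    by (rule nn_integral_disc_area_polar) measurable
  also have "\<dots> = (\<integral>\<^sup>+w. \<omega> (defect w) \<partial>disc_area)"
  proof (rule nn_integral_cong)
    fix w assume "w \<in> space disc_area"
    then have w: "norm (cnj v * w) < 1"
      using v mult_strict_mono'[of "norm v" 1 "norm w" 1] by (simp add: norm_mult)
    have "(\<integral>\<^sup>+\<zeta>. \<omega> (defect (w * \<zeta>)) * ennreal (poisson (v * cnj (w * \<zeta>))) \<partial>circle_measure) =
      (\<integral>\<^sup>+\<zeta>. \<omega> (defect w) * ennreal (poisson (cnj v * w * \<zeta>)) \<partial>circle_measure)"
    proof (intro nn_integral_cong_AE, use AE_circle_measure in eventually_elim)
      case (elim \<zeta>)
      have "poisson (v * cnj (w * \<zeta>)) = poisson (cnj v * w * \<zeta>)"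
        by (subst poisson_cnj[symmetric]) (simp add: mult_ac)
      with elim show ?case by (simp add: defect_mult_circle)
    qed
    also have "\<dots> = \<omega> (defect w)"
      by (simp add: nn_integral_cmult poisson_mean[OF w])
    finally show "(\<integral>\<^sup>+\<zeta>. \<omega> (defect (w * \<zeta>)) * ennreal (poisson (v * cnj (w * \<zeta>))) \<partial>circle_measure) = \<omega> (defect w)" .
  qed
  finally show ?thesis .
qed

text \<open>A pointwise bound of the product by a sum is multiplied by the kernel and integrated.
  The summand \<open>A w\<close> is integrated in \<zeta> first, the radial summand in
  \<open>w\<close> first; either way the kernel disappears, with no loss depending on
  \<open>z\<close>.\<close>

lemma poisson_double_integral_le:
  assumes z: "norm z < 1"
    and [measurable]: "\<alpha> \<in> borel_measurable disc_area" "h \<in> borel_measurable borel"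
      "A \<in> borel_measurable disc_area" "\<omega> \<in> borel_measurable borel" "B \<in> borel_measurable borel"
    and le: "\<And>w \<zeta>. norm w < 1 \<Longrightarrow> \<alpha> w * h \<zeta> \<le> A w + \<omega> (defect w) * B \<zeta>"
  shows "(\<integral>\<^sup>+w. \<alpha> w * (\<integral>\<^sup>+\<zeta>. h \<zeta> * ennreal (poisson (z * \<zeta> * cnj w)) \<partial>circle_measure) \<partial>disc_area) \<le>
    (\<integral>\<^sup>+w. A w \<partial>disc_area) + (\<integral>\<^sup>+w. \<omega> (defect w) \<partial>disc_area) * (\<integral>\<^sup>+\<zeta>. B \<zeta> \<partial>circle_measure)"
proof -
  let ?P = "\<lambda>w \<zeta>. ennreal (poisson (z * \<zeta> * cnj w))"
  have P[measurable]: "(\<lambda>(w, \<zeta>). ?P w \<zeta>) \<in> borel_measurable (disc_area \<Otimes>\<^sub>M circle_measure)"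
    by (intro measurable_disc_circle) measurable
  have om[measurable]: "(\<lambda>w. \<omega> (defect w)) \<in> borel_measurable disc_area"
    by (intro borel_measurable_disc_area) measurable
  have P1: "(\<integral>\<^sup>+\<zeta>. ?P w \<zeta> \<partial>circle_measure) = 1" if "norm w < 1" for w
  proof -
    have "norm (z * cnj w) < 1"
      using z that mult_strict_mono'[of "norm z" 1 "norm w" 1] by (simp add: norm_mult)
    from poisson_mean[OF this] show ?thesis by (simp add: mult_ac)
  qed
  have P2: "(\<integral>\<^sup>+w. \<omega> (defect w) * ?P w \<zeta> \<partial>disc_area) = (\<integral>\<^sup>+w. \<omega> (defect w) \<partial>disc_area)" if "norm \<zeta> = 1" for \<zeta>
    by (rule poisson_radial_mean) (use z that in \<open>simp_all add: norm_mult\<close>)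
  have "(\<integral>\<^sup>+w. \<alpha> w * (\<integral>\<^sup>+\<zeta>. h \<zeta> * ?P w \<zeta> \<partial>circle_measure) \<partial>disc_area) \<le>
     (\<integral>\<^sup>+w. A w + (\<integral>\<^sup>+\<zeta>. \<omega> (defect w) * B \<zeta> * ?P w \<zeta> \<partial>circle_measure) \<partial>disc_area)"
  proof (rule nn_integral_mono)
    fix w assume w: "w \<in> space disc_area"
    then have [measurable]: "?P w \<in> borel_measurable circle_measure"
      by measurable
    have "\<alpha> w * (\<integral>\<^sup>+\<zeta>. h \<zeta> * ?P w \<zeta> \<partial>circle_measure) = (\<integral>\<^sup>+\<zeta>. \<alpha> w * h \<zeta> * ?P w \<zeta> \<partial>circle_measure)"
      by (subst nn_integral_cmult[symmetric]) (auto simp: mult_ac)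
    also have "\<dots> \<le> (\<integral>\<^sup>+\<zeta>. (A w + \<omega> (defect w) * B \<zeta>) * ?P w \<zeta> \<partial>circle_measure)"
      using le[of w] w by (intro nn_integral_mono mult_right_mono) auto
    also have "\<dots> = A w * (\<integral>\<^sup>+\<zeta>. ?P w \<zeta> \<partial>circle_measure) + (\<integral>\<^sup>+\<zeta>. \<omega> (defect w) * B \<zeta> * ?P w \<zeta> \<partial>circle_measure)"
      by (simp add: distrib_right nn_integral_add nn_integral_cmult)
    finally show "\<alpha> w * (\<integral>\<^sup>+\<zeta>. h \<zeta> * ?P w \<zeta> \<partial>circle_measure) \<le> A w + (\<integral>\<^sup>+\<zeta>. \<omega> (defect w) * B \<zeta> * ?P w \<zeta> \<partial>circle_measure)"
      using w P1 by simp
  qed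
  also have "\<dots> = (\<integral>\<^sup>+w. A w \<partial>disc_area) + (\<integral>\<^sup>+w. \<integral>\<^sup>+\<zeta>. \<omega> (defect w) * B \<zeta> * ?P w \<zeta> \<partial>circle_measure \<partial>disc_area)"
    by (rule nn_integral_add) measurable
  also have "(\<integral>\<^sup>+w. \<integral>\<^sup>+\<zeta>. \<omega> (defect w) * B \<zeta> * ?P w \<zeta> \<partial>circle_measure \<partial>disc_area) =
      (\<integral>\<^sup>+\<zeta>. \<integral>\<^sup>+w. \<omega> (defect w) * B \<zeta> * ?P w \<zeta> \<partial>disc_area \<partial>circle_measure)"
    by (rule disc_circle_Fubini) measurable
  also have "\<dots> = (\<integral>\<^sup>+\<zeta>. (\<integral>\<^sup>+w. \<omega> (defect w) \<partial>disc_area) * B \<zeta> \<partial>circle_measure)"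
  proof (intro nn_integral_cong_AE, use AE_circle_measure in eventually_elim)
    case (elim \<zeta>)
    have [measurable]: "(\<lambda>w. ?P w \<zeta>) \<in> borel_measurable disc_area"
      by (intro borel_measurable_disc_area) measurable
    have "(\<integral>\<^sup>+w. \<omega> (defect w) * B \<zeta> * ?P w \<zeta> \<partial>disc_area) = (\<integral>\<^sup>+w. B \<zeta> * (\<omega> (defect w) * ?P w \<zeta>) \<partial>disc_area)"
      by (simp add: mult_ac)
    also have "\<dots> = B \<zeta> * (\<integral>\<^sup>+w. \<omega> (defect w) \<partial>disc_area)"
      by (simp add: nn_integral_cmult P2[OF elim])
    finally show ?case by (simp add: mult.commute)
  qed
  also have "\<dots> = (\<integral>\<^sup>+w. \<omega> (defect w) \<partial>disc_area) * (\<integral>\<^sup>+\<zeta>. B \<zeta> \<partial>circle_measure)"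
    by (simp add: nn_integral_cmult)
  finally show ?thesis .
qed

section \<open>From estimates on sets to estimates on Lorentz functions\<close>

interpretation disc_lborel: pair_sigma_finite disc_area "lborel :: real measure" ..

lemma superlevel_sets:
  "f \<in> borel_measurable disc_area \<Longrightarrow> superlevel f t \<in> sets disc_area"
  unfolding superlevel_def by measurable

text \<open>\<open>norm (f w)\<close> is the integral over \<open>t\<close> of the indicators of its
  superlevel sets, so after exchanging integrals a bound on sets suffices. This is where the second
  Lorentz index 1 is used.\<close>

lemma layer_cake_le:
  fixes D :: ennreal
  assumes f[measurable]: "f \<in> borel_measurable disc_area" and V[measurable]: "V \<in> borel_measurable disc_area"
    and le: "\<And>E. E \<in> sets disc_area \<Longrightarrow> 0 < measure disc_area E \<Longrightarrow>
        (\<integral>\<^sup>+w\<in>E. V w \<partial>disc_area) \<le> D * ennreal (measure disc_area E powr \<gamma>)"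
  shows "(\<integral>\<^sup>+w. ennreal (norm (f w)) * V w \<partial>disc_area) \<le>
    D * (\<integral>\<^sup>+t\<in>{0<..}. ennreal (measure disc_area (superlevel f t) powr \<gamma>) \<partial>lborel)"
proof -
  let ?\<mu> = "\<lambda>t. measure disc_area (superlevel f t)"
  have meas_sup: "?\<mu> \<in> borel_measurable lborel"
  proof -
    \<comment> \<open>Measurability in \<open>t\<close> comes from monotonicity.\<close>
    have "antimono ?\<mu>"
      unfolding antimono_def
      by (intro allI impI disc.finite_measure_mono superlevel_sets[OF f]) (auto simp: superlevel_def)
    then have "mono (\<lambda>t. - ?\<mu> t)" by (auto simp: monotone_def)
    then have "(\<lambda>t. - ?\<mu> t) \<in> borel_measurable borel" by (rule borel_measurable_mono)
    then have "(\<lambda>t. - (- ?\<mu> t)) \<in> borel_measurable borel" by (rule borel_measurable_uminus)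
    then show ?thesis by simp
  qed
  have [measurable]: "(\<lambda>(w, t). indicator {0<..<norm (f w)} t :: ennreal) \<in> borel_measurable (disc_area \<Otimes>\<^sub>M (lborel :: real measure))"
    unfolding indicator_def greaterThanLessThan_iff by measurable
  have "(\<integral>\<^sup>+w. ennreal (norm (f w)) * V w \<partial>disc_area) =
     (\<integral>\<^sup>+w. \<integral>\<^sup>+t. indicator {0<..<norm (f w)} t * V w \<partial>lborel \<partial>disc_area)"
    by (intro nn_integral_cong) (simp add: nn_integral_multc)
  also have "\<dots> = (\<integral>\<^sup>+t. \<integral>\<^sup>+w. indicator {0<..<norm (f w)} t * V w \<partial>disc_area \<partial>lborel)"
    by (rule disc_lborel.Fubini'[symmetric]) measurable
  also have "\<dots> \<le> (\<integral>\<^sup>+t. D * (ennreal (?\<mu> t powr \<gamma>) * indicator {0<..} t) \<partial>lborel)"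
  proof (rule nn_integral_mono)
    fix t :: real
    have [measurable]: "superlevel f t \<in> sets disc_area"
      by (rule superlevel_sets) measurable
    have "(\<integral>\<^sup>+w. indicator {0<..<norm (f w)} t * V w \<partial>disc_area) =
        (\<integral>\<^sup>+w. indicator {0<..} t * (V w * indicator (superlevel f t) w) \<partial>disc_area)"
      by (intro nn_integral_cong) (auto simp: superlevel_def split: split_indicator)
    also have "\<dots> = indicator {0<..} t * (\<integral>\<^sup>+w\<in>superlevel f t. V w \<partial>disc_area)"
      by (intro nn_integral_cmult) measurable
    also have "(\<integral>\<^sup>+w\<in>superlevel f t. V w \<partial>disc_area) \<le> D * ennreal (?\<mu> t powr \<gamma>)"
    \<comment> \<open>The assumed bound concerns sets of positive measure only, since its proof cuts
      at the measure of the set; a null level set contributes nothing.\<close>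
    proof (cases "?\<mu> t = 0")
      case True
      then have "superlevel f t \<in> null_sets disc_area"
        using superlevel_sets[OF f] by (simp add: null_sets_def disc.emeasure_eq_measure)
      then have "(\<integral>\<^sup>+w\<in>superlevel f t. V w \<partial>disc_area) = 0"
        by (rule nn_integral_null_set)
      then show ?thesis by simp
    next
      case False
      then show ?thesis
        using le[OF superlevel_sets[OF f]] by (simp add: zero_less_measure_iff)
    qed
    finally show "(\<integral>\<^sup>+w. indicator {0<..<norm (f w)} t * V w \<partial>disc_area) \<le> D * (ennreal (?\<mu> t powr \<gamma>) * indicator {0<..} t)"
      by (auto simp: mult_left_mono split: split_indicator)
  qed
  also have "\<dots> = D * (\<integral>\<^sup>+t\<in>{0<..}. ennreal (?\<mu> t powr \<gamma>) \<partial>lborel)"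
  proof (rule nn_integral_cmult)
    have "(\<lambda>t. ennreal (g t powr \<gamma>) * indicator {0<..} t) \<in> borel_measurable lborel"
      if [measurable]: "g \<in> borel_measurable lborel" for g :: "real \<Rightarrow> real"
      by measurable
    from this[OF meas_sup] show "(\<lambda>t. ennreal (?\<mu> t powr \<gamma>) * indicator {0<..} t) \<in> borel_measurable lborel" .
  qed
  finally show ?thesis .
qed

text \<open>For \<open>x > y\<close>, write \<open>x\<close> as
  \<open>x powr k * x powr (1 - k)\<close> and use that \<open>1 - k\<close> is negative. It plays
  the role of Young's inequality with a free threshold \<open>y\<close>.\<close>

lemma le_add_powr_split:
  fixes x y k :: real
  assumes "0 \<le> x" "0 < y" "1 < k"
  shows "x \<le> y + x powr k * y powr (1 - k)"
proof (cases "x \<le> y")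
  case True
  moreover have "0 \<le> x powr k * y powr (1 - k)" by simp
  ultimately show ?thesis by linarith
next
  case False
  then have "x powr (1 - k) \<le> y powr (1 - k)"
    using assms by (intro powr_mono2') auto
  then have "x powr k * x powr (1 - k) \<le> x powr k * y powr (1 - k)"
    by (intro mult_left_mono) auto
  moreover have "x powr k * x powr (1 - k) = x"
    using False assms by (simp flip: powr_add)
  ultimately show ?thesis using assms by linarith
qed

text \<open>
  With \<open>m\<close> the measure of \<open>E\<close>, the weight is split at \<open>defect w = m\<close>. In each region the product of the
  weight with \<open>h\<close> is linearised so that one summand is free of \<open>h\<close> and the other is radial in \<open>w\<close>;
  the Poisson kernel then integrates to \<open>1\<close> in either variable.
\<close>

lemma poisson_set_bound:
  fixes b k Y :: real and h :: "complex \<Rightarrow> real"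
  assumes b: "-1 < b" and k: "1 < k" "b * k < -1" and z: "norm z < 1"
    and [measurable]: "h \<in> borel_measurable borel" and h0: "\<And>\<zeta>. 0 \<le> h \<zeta>"
    and Y: "0 < Y" "(\<integral>\<^sup>+\<zeta>. ennreal (h \<zeta> powr k) \<partial>circle_measure) \<le> ennreal (Y powr k)"
    and E[measurable]: "E \<in> sets disc_area" and m0: "0 < measure disc_area E"
  shows "(\<integral>\<^sup>+w\<in>E. ennreal (defect w powr b) *
        (\<integral>\<^sup>+\<zeta>. ennreal (h \<zeta>) * ennreal (poisson (z * \<zeta> * cnj w)) \<partial>circle_measure) \<partial>disc_area)
    \<le> ennreal ((2 / (b + 1) + 1 + 1 / (- (b * k) - 1)) * Y) * ennreal (measure disc_area E powr (b + 1))"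
proof -
  define m where "m = measure disc_area E"
  have m: "0 < m" using m0 by (simp add: m_def)
  \<comment> \<open>The threshold for \<open>defect w powr b * h \<zeta>\<close> when
    \<open>h\<close> has size \<open>Y\<close> and the defect equals the cut \<open>m\<close>; then
    \<open>y * m\<close> has the desired order \<open>Y * m powr (b + 1)\<close>.\<close>
  define y where "y = m powr b * Y"
  have y: "0 < y" using m Y by (simp add: y_def)
  \<comment> \<open>\<open>A\<close> collects what is free of \<open>h\<close>, and
    \<open>\<omega>\<close> multiplies \<open>h powr k\<close>. Below the cut, \<open>h\<close>
    alone is split at \<open>Y\<close>; above it, the product with the weight is split at
    \<open>y\<close>, and the constant part \<open>y\<close> is integrated over \<open>E\<close>
    only, giving \<open>y * m\<close>.\<close>
  define A where "A w = ennreal Y * (ennreal (defect w powr b) * indicator {0..m} (defect w)) + ennreal y * indicator E w" for w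
  define \<omega> where "\<omega> x = ennreal (Y powr (1 - k)) * (ennreal (x powr b) * indicator {0..m} x)
      + ennreal (y powr (1 - k)) * (ennreal (x powr (b * k)) * indicator {m..} x)" for x
  have [measurable]: "\<omega> \<in> borel_measurable borel"
    unfolding \<omega>_def by measurable
  have near[measurable]: "(\<lambda>w. ennreal (defect w powr b) * indicator {0..m} (defect w)) \<in> borel_measurable disc_area"
    "(\<lambda>w. ennreal (defect w powr b)) \<in> borel_measurable disc_area"
    "(\<lambda>w. ennreal (defect w powr (b * k)) * indicator {m..} (defect w)) \<in> borel_measurable disc_area"
    by (intro borel_measurable_disc_area; measurable)+
  have [measurable]: "A \<in> borel_measurable disc_area"
    unfolding A_def by measurable
  have IA: "(\<integral>\<^sup>+w. A w \<partial>disc_area) \<le> ennreal ((1 / (b + 1) + 1) * Y * m powr (b + 1))"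
  proof -
    have "(\<integral>\<^sup>+w. A w \<partial>disc_area) = ennreal Y * (\<integral>\<^sup>+w. ennreal (defect w powr b) * indicator {0..m} (defect w) \<partial>disc_area) + ennreal y * emeasure disc_area E"
      unfolding A_def by (simp add: nn_integral_add nn_integral_cmult)
    also have "\<dots> \<le> ennreal Y * ennreal (m powr (b + 1) / (b + 1)) + ennreal y * ennreal m"
      using b m nn_integral_defect_near[of b m]
      by (intro add_mono mult_left_mono) (auto simp: m_def disc.emeasure_eq_measure)
    also have "\<dots> = ennreal (Y * (m powr (b + 1) / (b + 1)) + y * m)"
      using Y y m b by (subst ennreal_plus) (auto simp flip: ennreal_mult')
    also have "Y * (m powr (b + 1) / (b + 1)) + y * m = (1 / (b + 1) + 1) * Y * m powr (b + 1)"
      using m by (simp add: y_def powr_add distrib_right)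
    finally show ?thesis .
  qed
  have I\<omega>: "(\<integral>\<^sup>+w. \<omega> (defect w) \<partial>disc_area) \<le> ennreal ((1 / (b + 1) + 1 / (- (b * k) - 1)) * Y powr (1 - k) * m powr (b + 1))"
  proof -
    have "(\<integral>\<^sup>+w. \<omega> (defect w) \<partial>disc_area) =
        ennreal (Y powr (1 - k)) * (\<integral>\<^sup>+w. ennreal (defect w powr b) * indicator {0..m} (defect w) \<partial>disc_area)
      + ennreal (y powr (1 - k)) * (\<integral>\<^sup>+w. ennreal (defect w powr (b * k)) * indicator {m..} (defect w) \<partial>disc_area)"
      unfolding \<omega>_def by (simp add: nn_integral_add nn_integral_cmult)
    also have "\<dots> \<le> ennreal (Y powr (1 - k)) * ennreal (m powr (b + 1) / (b + 1))
      + ennreal (y powr (1 - k)) * ennreal (m powr (b * k + 1) / (- (b * k) - 1))"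
      using b k m nn_integral_defect_near[of b m] nn_integral_defect_far[of "b * k" m]
      by (intro add_mono mult_left_mono) auto
    also have "\<dots> = ennreal (Y powr (1 - k) * (m powr (b + 1) / (b + 1)) + y powr (1 - k) * (m powr (b * k + 1) / (- (b * k) - 1)))"
      using b k by (subst ennreal_plus) (auto simp flip: ennreal_mult')
    also have "y powr (1 - k) * (m powr (b * k + 1) / (- (b * k) - 1)) = Y powr (1 - k) * m powr (b + 1) / (- (b * k) - 1)"
    proof -
      have "y powr (1 - k) * m powr (b * k + 1) = Y powr (1 - k) * (m powr (b * (1 - k)) * m powr (b * k + 1))"
        using m Y by (simp add: y_def powr_mult powr_powr mult_ac)
      also have "m powr (b * (1 - k)) * m powr (b * k + 1) = m powr (b + 1)"
        by (subst powr_add[symmetric]) (simp add: algebra_simps)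
      finally show ?thesis by simp
    qed
    finally show ?thesis by (simp add: algebra_simps add_divide_distrib)
  qed
  have "(\<integral>\<^sup>+w\<in>E. ennreal (defect w powr b) * (\<integral>\<^sup>+\<zeta>. ennreal (h \<zeta>) * ennreal (poisson (z * \<zeta> * cnj w)) \<partial>circle_measure) \<partial>disc_area)
     = (\<integral>\<^sup>+w. (ennreal (defect w powr b) * indicator E w) * (\<integral>\<^sup>+\<zeta>. ennreal (h \<zeta>) * ennreal (poisson (z * \<zeta> * cnj w)) \<partial>circle_measure) \<partial>disc_area)"
    by (simp add: mult_ac)
  also have "\<dots> \<le> (\<integral>\<^sup>+w. A w \<partial>disc_area) + (\<integral>\<^sup>+w. \<omega> (defect w) \<partial>disc_area) * (\<integral>\<^sup>+\<zeta>. ennreal (h \<zeta> powr k) \<partial>circle_measure)"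
  proof (rule poisson_double_integral_le[OF z])
    fix w \<zeta> :: complex
    assume w: "norm w < 1"
    let ?s = "defect w"
    have s: "0 < ?s" by (rule defect_pos[OF w])
    show "ennreal (?s powr b) * indicator E w * ennreal (h \<zeta>) \<le> A w + \<omega> ?s * ennreal (h \<zeta> powr k)"
    proof (cases "w \<in> E")
      case True
      show ?thesis
      proof (cases "?s \<le> m")
        case True
        have "?s powr b * h \<zeta> \<le> ?s powr b * (Y + h \<zeta> powr k * Y powr (1 - k))"
          using le_add_powr_split[OF h0 Y(1) k(1)] by (intro mult_left_mono) auto
        also have "\<dots> = Y * ?s powr b + Y powr (1 - k) * ?s powr b * h \<zeta> powr k"
          by (simp add: algebra_simps)
        finally have "ennreal (?s powr b * h \<zeta>) \<le> ennreal (Y * ?s powr b) + ennreal (Y powr (1 - k) * ?s powr b * h \<zeta> powr k)"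
          using Y by (simp flip: ennreal_plus)
        also have "\<dots> = ennreal Y * ennreal (?s powr b) + ennreal (Y powr (1 - k)) * ennreal (?s powr b) * ennreal (h \<zeta> powr k)"
          using Y by (simp add: ennreal_mult')
        also have "\<dots> \<le> A w + \<omega> ?s * ennreal (h \<zeta> powr k)"
          using True s by (intro add_mono mult_right_mono) (auto simp: A_def \<omega>_def)
        finally show ?thesis
          using \<open>w \<in> E\<close> h0 by (simp add: ennreal_mult')
      next
        case False
        have "?s powr b * h \<zeta> \<le> y + (?s powr b * h \<zeta>) powr k * y powr (1 - k)"
          using h0 by (intro le_add_powr_split[OF _ y k(1)]) auto
        also have "(?s powr b * h \<zeta>) powr k = ?s powr (b * k) * h \<zeta> powr k"
          using h0 by (simp add: powr_mult powr_powr)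
        finally have "?s powr b * h \<zeta> \<le> y + y powr (1 - k) * ?s powr (b * k) * h \<zeta> powr k"
          by (simp add: mult_ac)
        then have "ennreal (?s powr b * h \<zeta>) \<le> ennreal y + ennreal (y powr (1 - k) * ?s powr (b * k) * h \<zeta> powr k)"
          using y by (simp flip: ennreal_plus)
        also have "\<dots> = ennreal y + ennreal (y powr (1 - k)) * ennreal (?s powr (b * k)) * ennreal (h \<zeta> powr k)"
          by (simp add: ennreal_mult')
        also have "\<dots> \<le> A w + \<omega> ?s * ennreal (h \<zeta> powr k)"
          using False s \<open>w \<in> E\<close> by (intro add_mono mult_right_mono) (auto simp: A_def \<omega>_def)
        finally show ?thesis
          using \<open>w \<in> E\<close> h0 by (simp add: ennreal_mult')
      qed
    qed simp
  qed measurable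
  also have "\<dots> \<le> ennreal ((1 / (b + 1) + 1) * Y * m powr (b + 1)) +
      ennreal ((1 / (b + 1) + 1 / (- (b * k) - 1)) * Y powr (1 - k) * m powr (b + 1)) * ennreal (Y powr k)"
    by (intro add_mono mult_mono IA I\<omega> Y(2)) auto
  also have "ennreal ((1 / (b + 1) + 1) * Y * m powr (b + 1)) +
      ennreal ((1 / (b + 1) + 1 / (- (b * k) - 1)) * Y powr (1 - k) * m powr (b + 1)) * ennreal (Y powr k)
      = ennreal ((2 / (b + 1) + 1 + 1 / (- (b * k) - 1)) * Y) * ennreal (m powr (b + 1))"
  proof -
    have YY: "Y powr (1 - k) * Y powr k = Y"
      using Y by (simp flip: powr_add)
    have nn: "0 \<le> 1 / (b + 1)" "0 \<le> 1 / (- (b * k) - 1)" using b k by auto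
    have "ennreal ((1 / (b + 1) + 1 / (- (b * k) - 1)) * Y powr (1 - k) * m powr (b + 1)) * ennreal (Y powr k)
      = ennreal ((1 / (b + 1) + 1 / (- (b * k) - 1)) * (Y powr (1 - k) * Y powr k) * m powr (b + 1))"
      using nn by (subst ennreal_mult[symmetric]) (auto simp: mult_ac intro!: mult_nonneg_nonneg)
    also have "ennreal ((1 / (b + 1) + 1) * Y * m powr (b + 1)) + \<dots> =
        ennreal ((1 / (b + 1) + 1) * Y * m powr (b + 1) + (1 / (b + 1) + 1 / (- (b * k) - 1)) * Y * m powr (b + 1))"
      unfolding YY using nn Y by (intro ennreal_plus[symmetric]) (auto intro!: mult_nonneg_nonneg add_nonneg_nonneg)
    also have "(1 / (b + 1) + 1) * Y * m powr (b + 1) + (1 / (b + 1) + 1 / (- (b * k) - 1)) * Y * m powr (b + 1)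
       = ((2 / (b + 1) + 1 + 1 / (- (b * k) - 1)) * Y) * m powr (b + 1)"
      by (simp add: algebra_simps)
    finally show ?thesis
      using nn Y by (simp add: ennreal_mult')
  qed
  finally show ?thesis
    by (simp add: m_def)
qed

text \<open>The kernel-free version of the same cut: near the boundary the whole weight is
  integrated, elsewhere it is at most \<open>m powr b\<close> because \<open>b < 0\<close>, on a set
  of measure \<open>m\<close>.\<close>

lemma weighted_set_bound:
  assumes b: "-1 < b" "b < 0" and [measurable]: "E \<in> sets disc_area" and m0: "0 < measure disc_area E"
  shows "(\<integral>\<^sup>+w\<in>E. ennreal (defect w powr b) \<partial>disc_area) \<le> ennreal (1 / (b + 1) + 1) * ennreal (measure disc_area E powr (b + 1))"
proof -
  define m where "m = measure disc_area E"
  have m: "0 < m" using m0 by (simp add: m_def)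
  have [measurable]: "(\<lambda>w. ennreal (defect w powr b) * indicator {0..m} (defect w)) \<in> borel_measurable disc_area"
    by (intro borel_measurable_disc_area) measurable
  have "(\<integral>\<^sup>+w\<in>E. ennreal (defect w powr b) \<partial>disc_area) \<le>
      (\<integral>\<^sup>+w. ennreal (defect w powr b) * indicator {0..m} (defect w) + ennreal (m powr b) * indicator E w \<partial>disc_area)"
  proof (rule nn_integral_mono)
    fix w assume "w \<in> space disc_area"
    then have s: "0 < defect w" by (simp add: defect_pos)
    have "defect w powr b \<le> m powr b" if "\<not> defect w \<le> m"
      using that m b by (intro powr_mono2') auto
    then show "ennreal (defect w powr b) * indicator E w \<le>
        ennreal (defect w powr b) * indicator {0..m} (defect w) + ennreal (m powr b) * indicator E w"
      using s by (auto split: split_indicator)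
  qed
  also have "\<dots> = (\<integral>\<^sup>+w. ennreal (defect w powr b) * indicator {0..m} (defect w) \<partial>disc_area) + ennreal (m powr b) * emeasure disc_area E"
    by (simp add: nn_integral_add nn_integral_cmult)
  also have "\<dots> \<le> ennreal (m powr (b + 1) / (b + 1)) + ennreal (m powr b) * ennreal m"
    using nn_integral_defect_near[of b m] b m
    by (intro add_mono) (auto simp: m_def disc.emeasure_eq_measure)
  also have "\<dots> = ennreal (m powr (b + 1) / (b + 1) + m powr b * m)"
    using m b by (subst ennreal_plus) (auto simp flip: ennreal_mult')
  also have "m powr (b + 1) / (b + 1) + m powr b * m = (1 / (b + 1) + 1) * m powr (b + 1)"
    using m by (simp add: powr_add distrib_right)
  also have "ennreal \<dots> = ennreal (1 / (b + 1) + 1) * ennreal (m powr (b + 1))"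
    using b by (intro ennreal_mult') auto
  finally show ?thesis by (simp add: m_def)
qed

lemma borel_measurable_weight: "(\<lambda>w. defect w powr b) \<in> borel_measurable disc_area"
  by (intro borel_measurable_disc_area) measurable

text \<open>The weight times \<open>f\<close> is integrable, so integrals against any kernel bounded
  in \<open>w\<close> converge absolutely.\<close>

lemma weighted_integral_bound:
  assumes b: "-1 < b" "b < 0" and [measurable]: "f \<in> borel_measurable disc_area"
    and L: "(\<integral>\<^sup>+t\<in>{0<..}. ennreal (measure disc_area (superlevel f t) powr (b + 1)) \<partial>lborel) \<le> ennreal L"
  shows "(\<integral>\<^sup>+w. ennreal (defect w powr b * norm (f w)) \<partial>disc_area) \<le> ennreal ((1 / (b + 1) + 1) * L)"
proof -
  have [measurable]: "(\<lambda>w. ennreal (defect w powr b)) \<in> borel_measurable disc_area"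
    using borel_measurable_weight by measurable
  have "(\<integral>\<^sup>+w. ennreal (defect w powr b * norm (f w)) \<partial>disc_area) =
      (\<integral>\<^sup>+w. ennreal (norm (f w)) * ennreal (defect w powr b) \<partial>disc_area)"
    by (simp add: ennreal_mult mult.commute)
  also have "\<dots> \<le> ennreal (1 / (b + 1) + 1) *
      (\<integral>\<^sup>+t\<in>{0<..}. ennreal (measure disc_area (superlevel f t) powr (b + 1)) \<partial>lborel)"
    by (rule layer_cake_le) (use weighted_set_bound[OF b] borel_measurable_weight in auto)
  also have "\<dots> \<le> ennreal (1 / (b + 1) + 1) * ennreal L"
    by (intro mult_left_mono L) simp
  also have "\<dots> = ennreal ((1 / (b + 1) + 1) * L)"
    using b by (intro ennreal_mult'[symmetric]) auto
  finally show ?thesis .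
qed

lemma norm_mult_cnj_less_1: "norm z < 1 \<Longrightarrow> norm w < 1 \<Longrightarrow> norm (z * cnj w) < 1"
  using mult_strict_mono'[of "norm z" 1 "norm w" 1] by (simp add: norm_mult)

text \<open>
  Duality with the test function \<open>h = U powr (r - 1)\<close>, whose \<open>k\<close>-th power is \<open>U powr r\<close>: this gives
  \<open>X \<le> D * L * X powr (1 / k)\<close> for the mean \<open>X\<close> of \<open>U powr r\<close>, which is finite since \<open>U\<close> is bounded
  on each circle of radius less than \<open>1\<close>.
\<close>

lemma poisson_integral_power_bound:
  fixes f :: "complex \<Rightarrow> complex" and \<phi> :: "complex \<Rightarrow> real"
  assumes b: "-1 < b" "b < 0" and r: "1 < r" "r * (b + 1) < 1" and z: "norm z < 1"
    and f[measurable]: "f \<in> borel_measurable disc_area" and \<phi>[measurable]: "\<phi> \<in> borel_measurable disc_area"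
    and \<phi>0: "\<And>w. 0 \<le> \<phi> w" and \<phi>f: "\<And>w. \<phi> w \<le> norm (f w)"
    and L: "0 < L" "(\<integral>\<^sup>+t\<in>{0<..}. ennreal (measure disc_area (superlevel f t) powr (b + 1)) \<partial>lborel) \<le> ennreal L"
  defines "k \<equiv> r / (r - 1)"
  defines "D \<equiv> 2 / (b + 1) + 1 + 1 / (- (b * k) - 1)"
  defines "U \<equiv> \<lambda>\<zeta>. LINT w|disc_area. defect w powr b * \<phi> w * poisson (z * \<zeta> * cnj w)"
  shows "(\<integral>\<^sup>+\<zeta>. ennreal (U \<zeta> powr r) \<partial>circle_measure) \<le> ennreal ((D * L) powr r)"
proof -
  note [measurable] = borel_measurable_weight
  define g where "g w = defect w powr b * \<phi> w" for w
  have [measurable]: "g \<in> borel_measurable disc_area"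
    unfolding g_def by measurable
  have g0: "0 \<le> g w" for w using \<phi>0 by (simp add: g_def)
  \<comment> \<open>\<open>k\<close> is the exponent conjugate to \<open>r\<close>, and
    \<open>b * k < -1\<close> is a rewriting of \<open>r * (b + 1) < 1\<close>.\<close>
  have k: "1 < k" "b * k < -1"
    using r by (simp_all add: k_def field_simps)
  have D: "0 < D"
    using k b by (auto simp: D_def intro!: add_pos_pos)
  have "(\<integral>\<^sup>+w. ennreal (norm (g w)) \<partial>disc_area) \<le> (\<integral>\<^sup>+w. ennreal (defect w powr b * norm (f w)) \<partial>disc_area)"
    using \<phi>0 \<phi>f by (intro nn_integral_mono ennreal_leI) (auto simp: g_def abs_mult intro!: mult_left_mono)
  also have "\<dots> \<le> ennreal ((1 / (b + 1) + 1) * L)"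
    by (rule weighted_integral_bound[OF b f L(2)])
  finally have "(\<integral>\<^sup>+w. ennreal (norm (g w)) \<partial>disc_area) < \<infinity>"
    by (rule order.strict_trans1) simp
  then have gint: "integrable disc_area g"
    by (intro integrableI_bounded) measurable
  have P[measurable]: "(\<lambda>(w, \<zeta>). poisson (z * \<zeta> * cnj w)) \<in> borel_measurable (disc_area \<Otimes>\<^sub>M circle_measure)"
    by (intro measurable_disc_circle) measurable
  have Pw[measurable]: "(\<lambda>w. poisson (v * cnj w)) \<in> borel_measurable disc_area" for v
    by (intro borel_measurable_disc_area) measurable
  have lt: "norm (z * \<zeta> * cnj w) < 1" "norm (z * \<zeta> * cnj w) \<le> norm z" if "norm w < 1" "norm \<zeta> = 1" for w \<zeta>
    using z that norm_mult_cnj_less_1[of "z * \<zeta>" w] mult_left_mono[of "norm w" 1 "norm z"]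
    by (auto simp: norm_mult)
  define M where "M = 2 / (1 - norm z)"
  have M: "0 < M" using z by (simp add: M_def)
  have PM: "0 \<le> poisson (z * \<zeta> * cnj w)" "poisson (z * \<zeta> * cnj w) \<le> M" if "norm w < 1" "norm \<zeta> = 1" for w \<zeta>
  proof -
    note l = lt[OF that]
    show "0 \<le> poisson (z * \<zeta> * cnj w)" by (rule poisson_nonneg[OF l(1)])
    have "2 / (1 - norm (z * \<zeta> * cnj w)) \<le> M"
      unfolding M_def using z l by (intro divide_left_mono) auto
    then show "poisson (z * \<zeta> * cnj w) \<le> M" using poisson_upper[OF l(1)] by simp
  qed
  have int: "integrable disc_area (\<lambda>w. g w * poisson (z * \<zeta> * cnj w))" if "norm \<zeta> = 1" for \<zeta>
  proof (rule Bochner_Integration.integrable_bound[OF integrable_mult_right[OF gint, of M]])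
    show "AE w in disc_area. norm (g w * poisson (z * \<zeta> * cnj w)) \<le> norm (M * g w)"
      using PM[OF _ that] g0 M by (intro AE_I2) (auto simp: abs_mult mult.commute[of M] intro!: mult_left_mono)
  qed measurable
  have U_nn: "ennreal (U \<zeta>) = (\<integral>\<^sup>+w. ennreal (g w) * ennreal (poisson (z * \<zeta> * cnj w)) \<partial>disc_area)" if "norm \<zeta> = 1" for \<zeta>
  proof -
    have "(\<integral>\<^sup>+w. ennreal (g w * poisson (z * \<zeta> * cnj w)) \<partial>disc_area) = ennreal (U \<zeta>)"
      unfolding U_def g_def[symmetric] using PM[OF _ that] g0
      by (intro nn_integral_eq_integral int[OF that] AE_I2) auto
    then show ?thesis using g0 by (simp add: ennreal_mult')
  qed
  have U0: "0 \<le> U \<zeta>" if "norm \<zeta> = 1" for \<zeta>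
    unfolding U_def g_def[symmetric] using PM[OF _ that] g0 by (intro integral_nonneg_AE AE_I2) auto
  have UM: "U \<zeta> \<le> M * (LINT w|disc_area. g w)" if "norm \<zeta> = 1" for \<zeta>
    unfolding U_def g_def[symmetric] integral_mult_right_zero[symmetric]
    using PM[OF _ that] g0 int[OF that] integrable_mult_right[OF gint, of M]
    by (intro integral_mono) (auto simp: mult.commute[of M] intro!: mult_left_mono)
  have [measurable]: "U \<in> borel_measurable circle_measure"
    unfolding U_def g_def[symmetric]
    using measurable_compose[OF measurable_pair_swap' P]
    by (intro disc.borel_measurable_lebesgue_integral) (auto simp: split_beta' intro!: borel_measurable_times)
  then have [measurable]: "U \<in> borel_measurable borel"
    by (simp add: measurable_cong_sets[OF sets_circle_measure refl])
  \<comment> \<open>Finiteness of \<open>X\<close> must be settled first: the final step divides by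
    a power of it.\<close>
  define X where "X = (\<integral>\<^sup>+\<zeta>. ennreal (U \<zeta> powr r) \<partial>circle_measure)"
  have "X \<le> (\<integral>\<^sup>+\<zeta>. ennreal ((M * (LINT w|disc_area. g w)) powr r) \<partial>circle_measure)"
    unfolding X_def
    by (intro nn_integral_mono_AE, use AE_circle_measure in eventually_elim)
       (use U0 UM r in \<open>auto intro!: ennreal_leI powr_mono2\<close>)
  also have "\<dots> < \<infinity>"
    by (simp add: emeasure_space_circle_measure)
  finally obtain x where x: "X = ennreal x" "0 \<le> x"
    by (cases X) auto
  show ?thesis
  proof (cases "x = 0")
    case True
    then show ?thesis using x by (simp add: X_def)
  next
    case False
    with x have x0: "0 < x" by simp
    \<comment> \<open>The norm of the test function \<open>h\<close> in the dual exponent, so that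
      the hypothesis on \<open>h\<close> in \<open>poisson_set_bound\<close> holds with
      equality.\<close>
    define Y where "Y = x powr (1 / k)"
    have Y: "0 < Y" "Y powr k = x" using x0 k by (simp_all add: Y_def powr_powr)
    define h where "h \<zeta> = U \<zeta> powr (r - 1)" for \<zeta>
    have [measurable]: "h \<in> borel_measurable borel"
      unfolding h_def by measurable
    have h0: "0 \<le> h \<zeta>" for \<zeta> by (simp add: h_def)
    have hk: "h \<zeta> powr k = U \<zeta> powr r" for \<zeta>
      using r by (simp add: h_def k_def powr_powr)
    define V where "V w = ennreal (defect w powr b) * (\<integral>\<^sup>+\<zeta>. ennreal (h \<zeta>) * ennreal (poisson (z * \<zeta> * cnj w)) \<partial>circle_measure)" for w
    have [measurable]: "V \<in> borel_measurable disc_area"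
      unfolding V_def by measurable
    have "X = (\<integral>\<^sup>+\<zeta>. (\<integral>\<^sup>+w. ennreal (g w) * ennreal (poisson (z * \<zeta> * cnj w)) * ennreal (h \<zeta>) \<partial>disc_area) \<partial>circle_measure)"
      unfolding X_def
    proof (intro nn_integral_cong_AE, use AE_circle_measure in eventually_elim)
      case (elim \<zeta>)
      have "U \<zeta> powr r = U \<zeta> * h \<zeta>"
        using U0[OF elim] r by (cases "U \<zeta> = 0") (auto simp: h_def powr_diff)
      then have "ennreal (U \<zeta> powr r) = ennreal (U \<zeta>) * ennreal (h \<zeta>)"
        using U0[OF elim] by (simp add: ennreal_mult')
      then show ?case
        by (simp add: U_nn[OF elim] nn_integral_multc)
    qed
    also have "\<dots> = (\<integral>\<^sup>+w. (\<integral>\<^sup>+\<zeta>. ennreal (g w) * ennreal (poisson (z * \<zeta> * cnj w)) * ennreal (h \<zeta>) \<partial>circle_measure) \<partial>disc_area)"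
      by (rule disc_circle_Fubini[symmetric]) measurable
    also have "\<dots> \<le> (\<integral>\<^sup>+w. ennreal (norm (f w)) * V w \<partial>disc_area)"
    proof (rule nn_integral_mono)
      fix w assume w: "w \<in> space disc_area"
      have [measurable]: "(\<lambda>\<zeta>. poisson (z * \<zeta> * cnj w)) \<in> borel_measurable circle_measure"
        by measurable
      have "(\<integral>\<^sup>+\<zeta>. ennreal (g w) * ennreal (poisson (z * \<zeta> * cnj w)) * ennreal (h \<zeta>) \<partial>circle_measure) =
         ennreal (\<phi> w) * V w"
        unfolding V_def g_def using \<phi>0
        by (simp add: ennreal_mult' nn_integral_cmult[symmetric] mult_ac)
      also have "\<dots> \<le> ennreal (norm (f w)) * V w"
        using \<phi>f by (intro mult_right_mono ennreal_leI) auto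
      finally show "(\<integral>\<^sup>+\<zeta>. ennreal (g w) * ennreal (poisson (z * \<zeta> * cnj w)) * ennreal (h \<zeta>) \<partial>circle_measure) \<le> ennreal (norm (f w)) * V w" .
    qed
    also have "\<dots> \<le> ennreal (D * Y) * (\<integral>\<^sup>+t\<in>{0<..}. ennreal (measure disc_area (superlevel f t) powr (b + 1)) \<partial>lborel)"
    proof (rule layer_cake_le)
      fix E assume "E \<in> sets disc_area" "0 < measure disc_area E"
      then show "(\<integral>\<^sup>+w\<in>E. V w \<partial>disc_area) \<le> ennreal (D * Y) * ennreal (measure disc_area E powr (b + 1))"
        unfolding V_def D_def using b k z h0 Y
        by (intro poisson_set_bound) (auto simp: hk x(1)[symmetric] X_def)
    qed measurable
    also have "\<dots> \<le> ennreal (D * Y) * ennreal L"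
      by (intro mult_left_mono L) simp
    also have "\<dots> = ennreal (D * L * Y)"
      using D Y by (subst ennreal_mult'[symmetric]) (auto simp: mult_ac)
    finally have "x \<le> D * L * Y"
      using D Y L by (simp add: x)
    then have "x / Y \<le> D * L"
      using Y by (simp add: field_simps)
    also have "x / Y = x powr (1 / r)"
    proof -
      have "x / Y = x powr (1 - 1 / k)"
        using x0 by (simp add: Y_def powr_diff)
      moreover have "1 - 1 / k = 1 / r" using r by (simp add: k_def field_simps)
      ultimately show ?thesis by simp
    qed
    finally have "(x powr (1 / r)) powr r \<le> (D * L) powr r"
      using r by (intro powr_mono2) auto
    then have "x \<le> (D * L) powr r"
      using x0 r by (simp add: powr_powr)
    then show ?thesis
      using x by (simp add: X_def)
  qed
qed

subsection \<open>Means of holomorphic functions with positive real part\<close>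

text \<open>By homogeneity only the argument \<open>x\<close> of \<open>F\<close> matters, and the
  claim becomes \<open>1 \<le> A * cos x powr r + B * cos (r * x)\<close> for \<open>x\<close>
  between 0 and \<open>pi / 2\<close>. Near \<open>pi / 2\<close> the second cosine stays away from
  0, and \<open>B\<close> is given its sign; elsewhere \<open>cos x\<close> is bounded below and a
  large \<open>A\<close> wins.\<close>

lemma riesz_pointwise:
  fixes r :: real
  assumes r: "0 < r" and c: "cos (r * (pi / 2)) \<noteq> 0"
  obtains A B where "0 < A"
    "\<And>F. 0 < Re F \<Longrightarrow> norm F powr r \<le> A * Re F powr r + B * Re (F powr complex_of_real r)"
proof -
  \<comment> \<open>Half the limiting modulus: a variation below \<open>c\<close> near
    \<open>pi / 2\<close> still leaves \<open>\<sigma> * cos (r * x)\<close> at least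
    \<open>2 * c - c\<close>.\<close>
  define c where "c = \<bar>cos (r * (pi / 2))\<bar> / 2"
  define \<sigma> where "\<sigma> = sgn (cos (r * (pi / 2)))"
  have c0: "0 < c" using c by (simp add: c_def)
  have "isCont (\<lambda>x. cos (r * x)) (pi / 2)"
    by (intro continuous_intros)
  then obtain d where d: "0 < d" and dc: "\<And>x. \<bar>x - pi / 2\<bar> < d \<Longrightarrow> \<bar>cos (r * x) - cos (r * (pi / 2))\<bar> < c"
    unfolding continuous_at_eps_delta dist_real_def using c0 by meson
  define e where "e = min d (pi / 4)"
  have e: "0 < e" "e \<le> d" "e < pi / 2" using d pi_gt_zero by (auto simp: e_def min_def)
  define \<kappa> where "\<kappa> = sin e"
  have \<kappa>: "0 < \<kappa>" unfolding \<kappa>_def using e by (intro sin_gt_zero) auto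
  \<comment> \<open>Where \<open>cos x\<close> is at least \<open>\<kappa>\<close>, the first term
    is at least \<open>1 + 1 / c\<close>, and \<open>1 / c\<close> is the most that the
    \<open>B\<close> term can subtract.\<close>
  define A where "A = (1 + 1 / c) / \<kappa> powr r"
  define B where "B = \<sigma> / c"
  have A: "0 < A" using \<kappa> c0 by (auto simp: A_def intro!: divide_pos_pos add_pos_pos)
  have s1: "\<bar>\<sigma>\<bar> = 1" using c by (simp add: \<sigma>_def abs_sgn_eq)
  have angle: "1 \<le> A * cos x powr r + B * cos (r * x)" if x: "0 \<le> x" "x < pi / 2" for x
  proof (cases "pi / 2 - e < x")
    case True
    then have "\<bar>cos (r * x) - cos (r * (pi / 2))\<bar> < c"
      using e x by (intro dc) auto
    moreover have "\<sigma> * cos (r * (pi / 2)) = 2 * c"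
      by (simp add: \<sigma>_def c_def sgn_mult_self_eq mult.commute abs_sgn[symmetric])
    moreover have "\<bar>\<sigma> * cos (r * x) - \<sigma> * cos (r * (pi / 2))\<bar> = \<bar>cos (r * x) - cos (r * (pi / 2))\<bar>"
      using s1 by (simp add: right_diff_distrib[symmetric] abs_mult)
    ultimately have "c \<le> \<sigma> * cos (r * x)" by linarith
    then have "1 \<le> B * cos (r * x)" using c0 by (simp add: B_def field_simps)
    moreover have "0 \<le> A * cos x powr r" using A by simp
    ultimately show ?thesis by linarith
  next
    case False
    have "\<kappa> = cos (pi / 2 - e)" by (simp add: \<kappa>_def sin_cos_eq)
    also have "\<dots> \<le> cos x" using False x e by (intro cos_monotone_0_pi_le) auto
    finally have "\<kappa> powr r \<le> cos x powr r" using \<kappa> r by (intro powr_mono2) auto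
    then have "A * \<kappa> powr r \<le> A * cos x powr r" using A by (intro mult_left_mono) auto
    moreover have "A * \<kappa> powr r = 1 + 1 / c" using \<kappa> by (simp add: A_def)
    moreover have "\<bar>B * cos (r * x)\<bar> \<le> 1 / c"
      using s1 c0 by (simp add: B_def abs_mult divide_right_mono)
    ultimately show ?thesis by linarith
  qed
  show ?thesis
  proof (rule that[OF A])
    fix F :: complex
    assume F: "0 < Re F"
    then have F0: "F \<noteq> 0" by auto
    define x where "x = Im (Ln F)"
    have x: "\<bar>x\<bar> < pi / 2" using Re_Ln_pos_lt[OF F0] F by (simp only: x_def)
    have nF: "exp (Re (Ln F)) = norm F" using F0 by (metis exp_Ln norm_exp_eq_Re)
    have "Re F = Re (exp (Ln F))" using F0 by simp
    also have "\<dots> = norm F * cos x" by (simp add: Re_exp nF x_def)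
    finally have ReF: "Re F = norm F * cos x" .
    have "Re (F powr complex_of_real r) = Re (exp (of_real r * Ln F))"
      using F0 by (simp add: powr_def)
    also have "\<dots> = norm F powr r * cos (r * x)"
      using F0 by (simp add: Re_exp x_def powr_def)
    finally have ReP: "Re (F powr complex_of_real r) = norm F powr r * cos (r * x)" .
    have "1 \<le> A * cos x powr r + B * cos (r * x)"
      using angle[of "\<bar>x\<bar>"] x by (cases "0 \<le> x") auto
    then have "norm F powr r * 1 \<le> norm F powr r * (A * cos x powr r + B * cos (r * x))"
      by (intro mult_left_mono) auto
    also have "\<dots> = A * Re F powr r + B * Re (F powr complex_of_real r)"
      unfolding ReF ReP using x cos_gt_zero_pi[of x] by (simp add: powr_mult algebra_simps)
    finally show "norm F powr r \<le> A * Re F powr r + B * Re (F powr complex_of_real r)" by simp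
  qed
qed

text \<open>The pointwise inequality is integrated over a circle. Its last term is the real part of
  a holomorphic function, so its mean is the value at the centre, of modulus at most
  \<open>norm (F 0) powr r\<close>.\<close>

lemma riesz_mean:
  fixes r A B x :: real
  assumes A: "0 < A" and pt: "\<And>F. 0 < Re F \<Longrightarrow> norm F powr r \<le> A * Re F powr r + B * Re (F powr complex_of_real r)"
    and [measurable]: "F \<in> borel_measurable borel" and hol: "F holomorphic_on ball 0 1"
    and pos: "\<And>z. norm z < 1 \<Longrightarrow> 0 < Re (F z)" and z: "norm z < 1"
    and x: "(\<integral>\<^sup>+\<zeta>. ennreal (Re (F (z * \<zeta>)) powr r) \<partial>circle_measure) \<le> ennreal x" "0 \<le> x"
  shows "(\<integral>\<^sup>+\<zeta>. ennreal (norm (F (z * \<zeta>)) powr r) \<partial>circle_measure) \<le> ennreal (A * x + \<bar>B\<bar> * norm (F 0) powr r)"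
proof -
  define R where "R = (if z = 0 then 2 else 1 / norm z)"
  have R: "1 < R" using z by (auto simp: R_def)
  have lt: "norm (z * \<zeta>) < 1" if "norm \<zeta> < R" for \<zeta>
    using that by (auto simp: R_def norm_mult field_simps split: if_splits)
  have F0: "F (z * \<zeta>) \<notin> \<real>\<^sub>\<le>\<^sub>0" if "norm \<zeta> < R" for \<zeta>
    using pos[OF lt[OF that]] by (auto simp: complex_nonpos_Reals_iff)
  have Fm: "(\<lambda>\<zeta>. F (z * \<zeta>)) \<in> borel_measurable borel" by measurable
  have "(\<lambda>\<zeta>. F (z * \<zeta>)) holomorphic_on ball 0 R"
    by (rule holomorphic_on_compose_gen[OF _ hol, unfolded o_def])
       (auto intro!: holomorphic_intros lt)
  \<comment> \<open>The complex power is unfolded into \<open>exp\<close> and \<open>Ln\<close>; the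
    two agree since \<open>F\<close> does not vanish, and the positive real part keeps
    \<open>Ln\<close> holomorphic.\<close>
  then have "(\<lambda>\<zeta>. exp (of_real r * Ln (F (z * \<zeta>)))) holomorphic_on ball 0 R"
    using F0 by (intro holomorphic_intros) auto
  from circle_measure_mean_value[OF this R]
  have "has_bochner_integral circle_measure (\<lambda>\<zeta>. exp (of_real r * Ln (F (z * \<zeta>)))) (exp (of_real r * Ln (F 0)))"
    by simp
  from has_bochner_integral_Re[OF this]
  have P: "has_bochner_integral circle_measure (\<lambda>\<zeta>. Re (exp (of_real r * Ln (F (z * \<zeta>))))) (Re (exp (of_real r * Ln (F 0))))" .
  have F00: "F 0 \<noteq> 0" using pos[of 0] by auto
  have "\<bar>Re (exp (of_real r * Ln (F 0)))\<bar> \<le> norm (exp (of_real r * Ln (F 0)))"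
    by (rule abs_Re_le_cmod)
  also have "\<dots> = norm (F 0) powr r"
    using F00 by (simp add: norm_exp_eq_Re powr_def)
  finally have P0: "\<bar>Re (exp (of_real r * Ln (F 0)))\<bar> \<le> norm (F 0) powr r" .
  let ?u = "\<lambda>\<zeta>. Re (F (z * \<zeta>)) powr r"
  have u: "integrable circle_measure ?u"
  proof (rule integrableI_bounded)
    show "(\<integral>\<^sup>+\<zeta>. ennreal (norm (?u \<zeta>)) \<partial>circle_measure) < \<infinity>"
      using order.strict_trans1[OF x(1), of \<infinity>] by simp
  qed measurable
  have ux: "integral\<^sup>L circle_measure ?u \<le> x"
    using x nn_integral_eq_integral[OF u] by simp
  let ?rhs = "\<lambda>\<zeta>. A * ?u \<zeta> + B * Re (exp (of_real r * Ln (F (z * \<zeta>))))"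
  have rhs: "has_bochner_integral circle_measure ?rhs (A * integral\<^sup>L circle_measure ?u + B * Re (exp (of_real r * Ln (F 0))))"
    by (intro has_bochner_integral_add has_bochner_integral_mult_right P) (use u in \<open>simp add: has_bochner_integral_iff\<close>)
  have le: "AE \<zeta> in circle_measure. norm (F (z * \<zeta>)) powr r \<le> ?rhs \<zeta>"
    using AE_circle_measure
  proof eventually_elim
    case (elim \<zeta>)
    have "0 < Re (F (z * \<zeta>))" using elim R by (intro pos lt) auto
    moreover from this have "F (z * \<zeta>) \<noteq> 0" by auto
    ultimately show ?case using pt[of "F (z * \<zeta>)"] by (simp add: powr_def)
  qed
  then have "(\<integral>\<^sup>+\<zeta>. ennreal (norm (F (z * \<zeta>)) powr r) \<partial>circle_measure) \<le> (\<integral>\<^sup>+\<zeta>. ennreal (?rhs \<zeta>) \<partial>circle_measure)"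
    by (intro nn_integral_mono_AE) (auto elim!: eventually_mono intro!: ennreal_leI)
  also have "\<dots> = ennreal (A * integral\<^sup>L circle_measure ?u + B * Re (exp (of_real r * Ln (F 0))))"
  proof (subst nn_integral_eq_integral)
    show "AE \<zeta> in circle_measure. 0 \<le> ?rhs \<zeta>"
      using le by eventually_elim (meson order_trans powr_ge_zero)
  qed (use rhs in \<open>simp_all add: has_bochner_integral_iff\<close>)
  also have "\<dots> \<le> ennreal (A * x + \<bar>B\<bar> * norm (F 0) powr r)"
  proof (rule ennreal_leI)
    have "B * Re (exp (of_real r * Ln (F 0))) \<le> \<bar>B\<bar> * \<bar>Re (exp (of_real r * Ln (F 0)))\<bar>"
      by (metis abs_ge_self abs_mult)
    also have "\<dots> \<le> \<bar>B\<bar> * norm (F 0) powr r" by (intro mult_left_mono P0) simp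
    finally show "A * integral\<^sup>L circle_measure ?u + B * Re (exp (of_real r * Ln (F 0))) \<le> A * x + \<bar>B\<bar> * norm (F 0) powr r"
      using ux A by (intro add_mono mult_left_mono) auto
  qed
  finally show ?thesis .
qed

section \<open>The Cauchy transform and its circle means\<close>

definition cauchy_transform :: "(complex \<Rightarrow> complex) \<Rightarrow> complex \<Rightarrow> complex" where
  "cauchy_transform g z = (LINT w|disc_area. g w / (1 - z * cnj w))"

lemma borel_measurable_disc_parametric:
  assumes [measurable]: "g \<in> borel_measurable disc_area"
  shows "(\<lambda>x. g (snd x) / (1 - fst x * cnj (snd x))) \<in> borel_measurable (borel \<Otimes>\<^sub>M disc_area)"
proof -
  have [measurable]: "cnj \<in> disc_area \<rightarrow>\<^sub>M borel"
    by (rule borel_measurable_disc_area) measurable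
  show ?thesis by measurable
qed

text \<open>Borel on the whole plane, including points where the integral may diverge and has its
  default value; the means over \<open>circle_measure\<close> need this global form.\<close>

lemma borel_measurable_cauchy_transform:
  assumes "g \<in> borel_measurable disc_area"
  shows "cauchy_transform g \<in> borel_measurable borel"
  unfolding cauchy_transform_def[abs_def]
  using borel_measurable_disc_parametric[OF assms]
  by (intro disc.borel_measurable_lebesgue_integral) (simp add: split_beta')

lemma cauchy_transform_integrable:
  assumes g: "integrable disc_area g" and z: "norm z < 1"
  shows "integrable disc_area (\<lambda>w. g w / (1 - z * cnj w))"
proof (rule Bochner_Integration.integrable_bound)
  show "integrable disc_area (\<lambda>w. (1 / (1 - norm z)) *\<^sub>R g w)"
    using g by (intro integrable_scaleR_right) 
  have [measurable]: "g \<in> borel_measurable disc_area" using g by auto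
  have [measurable]: "cnj \<in> disc_area \<rightarrow>\<^sub>M borel"
    by (rule borel_measurable_disc_area) measurable
  show "(\<lambda>w. g w / (1 - z * cnj w)) \<in> borel_measurable disc_area" by measurable
  show "AE w in disc_area. norm (g w / (1 - z * cnj w)) \<le> norm ((1 / (1 - norm z)) *\<^sub>R g w)"
  proof (rule AE_I2)
    fix w assume "w \<in> space disc_area"
    then have "norm (z * cnj w) \<le> norm z"
      using mult_left_mono[of "norm w" 1 "norm z"] by (simp add: norm_mult)
    then have "1 - norm z \<le> norm (1 - z * cnj w)"
      using norm_one_minus_ge[of "z * cnj w"] by linarith
    moreover from this have "0 < norm (1 - z * cnj w)" using z by linarith
    ultimately show "norm (g w / (1 - z * cnj w)) \<le> norm ((1 / (1 - norm z)) *\<^sub>R g w)"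
      using z by (auto simp: norm_divide intro!: divide_left_mono mult_pos_pos)
  qed
qed

text \<open>The kernel is expanded as a geometric series and integrated termwise, giving a power
  series in \<open>z\<close> whose coefficients are the integrals of
  \<open>g w * cnj w ^ n\<close>.\<close>

lemma cauchy_transform_holomorphic:
  assumes g: "integrable disc_area g"
  shows "cauchy_transform g holomorphic_on ball 0 1"
proof (rule power_series_holomorphic)
  fix z :: complex assume "z \<in> ball 0 1"
  then have z: "norm z < 1" by simp
  have [measurable]: "g \<in> borel_measurable disc_area" using g by auto
  have [measurable]: "cnj \<in> disc_area \<rightarrow>\<^sub>M borel"
    by (rule borel_measurable_disc_area) measurable
  let ?t = "\<lambda>n w. g w * (z * cnj w) ^ n"
  have le: "norm (?t n w) \<le> norm z ^ n * norm (g w)" if "norm w < 1" for n w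
  proof -
    have "norm (z * cnj w) ^ n \<le> norm z ^ n"
      using that mult_left_mono[of "norm w" 1 "norm z"] by (intro power_mono) (auto simp: norm_mult)
    then have "norm (g w) * norm (z * cnj w) ^ n \<le> norm (g w) * norm z ^ n"
      by (rule mult_left_mono) simp
    then show ?thesis by (simp only: norm_mult norm_power mult.commute)
  qed
  have ng: "integrable disc_area (\<lambda>w. norm z ^ n * norm (g w))" for n
    using g by (intro integrable_mult_right integrable_norm)
  have int: "integrable disc_area (?t n)" for n
    by (rule Bochner_Integration.integrable_bound[OF ng[of n]]) (use le in \<open>auto intro!: AE_I2\<close>)
  have sm: "summable (\<lambda>n. norm z ^ n * c)" for c
    using z by (intro summable_mult2 summable_geometric) simp
  have s1: "AE w in disc_area. summable (\<lambda>n. norm (?t n w))"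
    by (intro AE_I2 summable_comparison_test'[OF sm]) (use le in auto)
  have s2: "summable (\<lambda>n. LINT w|disc_area. norm (?t n w))"
  proof (rule summable_comparison_test'[OF sm[of "LINT w|disc_area. norm (g w)"]])
    fix n
    have "(LINT w|disc_area. norm (?t n w)) \<le> (LINT w|disc_area. norm z ^ n * norm (g w))"
      using le by (intro integral_mono integrable_norm int ng) auto
    then show "norm (LINT w|disc_area. norm (?t n w)) \<le> norm z ^ n * (LINT w|disc_area. norm (g w))"
      by simp
  qed
  have "(\<lambda>n. LINT w|disc_area. ?t n w) sums (LINT w|disc_area. (\<Sum>n. ?t n w))"
    by (rule sums_integral[OF int s1 s2])
  also have "(LINT w|disc_area. (\<Sum>n. ?t n w)) = cauchy_transform g z"
    unfolding cauchy_transform_def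
  proof (intro Bochner_Integration.integral_cong refl)
    fix w assume "w \<in> space disc_area"
    then have "norm (z * cnj w) < 1" using norm_mult_cnj_less_1[OF z] by simp
    from sums_mult[OF geometric_sums[OF this], of "g w"]
    show "(\<Sum>n. ?t n w) = g w / (1 - z * cnj w)" by (simp add: sums_iff)
  qed
  also have "(\<lambda>n. LINT w|disc_area. ?t n w) = (\<lambda>n. (LINT w|disc_area. g w * cnj w ^ n) * (z - 0) ^ n)"
  proof
    fix n
    have "?t n = (\<lambda>w. (g w * cnj w ^ n) * (z - 0) ^ n)"
      by (simp add: power_mult_distrib mult_ac)
    then show "(LINT w|disc_area. ?t n w) = (LINT w|disc_area. g w * cnj w ^ n) * (z - 0) ^ n"
      by (simp only: integral_mult_left_zero)
  qed
  finally show "(\<lambda>n. (LINT w|disc_area. g w * cnj w ^ n) * (z - 0) ^ n) sums cauchy_transform g z" .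
qed

lemma powr_add_le:
  fixes x y r :: real
  assumes "0 \<le> x" "0 \<le> y" "0 < r"
  shows "(x + y) powr r \<le> 2 powr r * (x powr r + y powr r)"
proof -
  have "(x + y) powr r \<le> (2 * max x y) powr r"
    using assms by (intro powr_mono2) auto
  also have "\<dots> = 2 powr r * max x y powr r"
    using assms by (simp add: powr_mult)
  also have "\<dots> \<le> 2 powr r * (x powr r + y powr r)"
    by (intro mult_left_mono) (auto simp: max_def)
  finally show ?thesis .
qed

text \<open>\<open>K\<close> depends on \<open>b\<close> and \<open>r\<close> alone. The density
  \<open>\<phi>\<close> is kept apart from \<open>f\<close> so that each nonnegative piece of a
  complex \<open>f\<close> is bounded through the Lorentz integral of \<open>f\<close>
  itself.\<close>

lemma cauchy_transform_mean_nonneg: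
  fixes b r :: real
  assumes b: "-1 < b" "b < 0" and r: "1 < r" "r * (b + 1) < 1" "cos (r * (pi / 2)) \<noteq> 0"
  obtains K where "0 \<le> K" "\<And>f \<phi> L z. \<lbrakk>f \<in> borel_measurable disc_area; \<phi> \<in> borel_measurable disc_area;
      \<And>w. 0 \<le> \<phi> w; \<And>w. \<phi> w \<le> norm (f w); 0 < L;
      (\<integral>\<^sup>+t\<in>{0<..}. ennreal (measure disc_area (superlevel f t) powr (b + 1)) \<partial>lborel) \<le> ennreal L; norm z < 1\<rbrakk> \<Longrightarrow>
      (\<integral>\<^sup>+\<zeta>. ennreal (norm (cauchy_transform (\<lambda>w. complex_of_real (defect w powr b * \<phi> w)) (z * \<zeta>)) powr r) \<partial>circle_measure)
        \<le> ennreal (K * L powr r)"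
proof -
  note [measurable] = borel_measurable_weight
  obtain A B where A: "0 < A" and pt: "\<And>F. 0 < Re F \<Longrightarrow> norm F powr r \<le> A * Re F powr r + B * Re (F powr complex_of_real r)"
    using riesz_pointwise[of r] r by (metis less_trans zero_less_one)
  define D where "D = 2 / (b + 1) + 1 + 1 / (- (b * (r / (r - 1))) - 1)"
  define E where "E = 1 / (b + 1) + 1"
  have E: "0 < E" using b by (simp add: E_def add_pos_pos)
  have "b * (r / (r - 1)) < -1" using r by (simp add: field_simps)
  then have D: "0 < D" using b by (auto simp: D_def intro!: add_pos_pos)
  \<comment> \<open>\<open>D * L\<close> bounds the mean of the real part and \<open>E * L\<close>
    the value \<open>G\<close> at the centre. The coefficient \<open>\<bar>B\<bar> + 1\<close>
    counts \<open>G\<close> once in \<open>riesz_mean\<close> and once in passing from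
    \<open>F\<close> back to \<open>H\<close>.\<close>
  define K where "K = A * D powr r + (\<bar>B\<bar> + 1) * E powr r"
  have K: "0 \<le> K" using A by (simp add: K_def)
  show ?thesis
  proof (rule that[OF K])
    fix f :: "complex \<Rightarrow> complex" and \<phi> :: "complex \<Rightarrow> real" and L :: real and z :: complex
    assume f[measurable]: "f \<in> borel_measurable disc_area" and \<phi>[measurable]: "\<phi> \<in> borel_measurable disc_area"
      and \<phi>0: "\<And>w. 0 \<le> \<phi> w" and \<phi>f: "\<And>w. \<phi> w \<le> norm (f w)" and L0: "0 < L"
      and L: "(\<integral>\<^sup>+t\<in>{0<..}. ennreal (measure disc_area (superlevel f t) powr (b + 1)) \<partial>lborel) \<le> ennreal L"
      and z: "norm z < 1"
    define g where "g w = defect w powr b * \<phi> w" for w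
    have [measurable]: "g \<in> borel_measurable disc_area" unfolding g_def by measurable
    have g0: "0 \<le> g w" for w using \<phi>0 by (simp add: g_def)
    define H where "H = cauchy_transform (\<lambda>w. complex_of_real (g w))"
    have "(\<integral>\<^sup>+w. ennreal (g w) \<partial>disc_area) \<le> (\<integral>\<^sup>+w. ennreal (defect w powr b * norm (f w)) \<partial>disc_area)"
      using \<phi>f by (intro nn_integral_mono ennreal_leI) (auto simp: g_def intro!: mult_left_mono)
    also have "\<dots> \<le> ennreal (E * L)"
      unfolding E_def by (rule weighted_integral_bound[OF b f L])
    finally have gE: "(\<integral>\<^sup>+w. ennreal (g w) \<partial>disc_area) \<le> ennreal (E * L)" .
    have gint: "integrable disc_area g"
      using g0 order.strict_trans1[OF gE, of \<infinity>] by (intro integrableI_bounded) auto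
    then have gcint: "integrable disc_area (\<lambda>w. complex_of_real (g w))" by simp
    define G where "G = (LINT w|disc_area. g w)"
    have G0: "0 \<le> G" unfolding G_def using g0 by simp
    have "ennreal G \<le> ennreal (E * L)"
      using gE g0 unfolding G_def by (simp add: nn_integral_eq_integral gint)
    then have GE: "G \<le> E * L" using E L0 by simp
    have H0: "H 0 = complex_of_real G" by (simp add: H_def cauchy_transform_def G_def)
    have Hm[measurable]: "H \<in> borel_measurable borel"
      unfolding H_def by (rule borel_measurable_cauchy_transform) measurable
    have Hhol: "H holomorphic_on ball 0 1"
      unfolding H_def by (rule cauchy_transform_holomorphic[OF gcint])
    define F where "F v = 2 * H v - H 0" for v
    have F0: "F 0 = complex_of_real G" by (simp add: F_def H0)
    have Hint: "integrable disc_area (\<lambda>w. complex_of_real (g w) / (1 - v * cnj w))" if "norm v < 1" for v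
      by (rule cauchy_transform_integrable[OF gcint that])
    have ReF: "Re (F v) = (LINT w|disc_area. g w * poisson (v * cnj w))"
      and ReF_int: "integrable disc_area (\<lambda>w. g w * poisson (v * cnj w))" if v: "norm v < 1" for v
    proof -
      let ?i = "\<lambda>w. 2 * (complex_of_real (g w) / (1 - v * cnj w)) - complex_of_real (g w)"
      have i: "integrable disc_area ?i"
        by (intro Bochner_Integration.integrable_diff integrable_mult_right Hint v gcint)
      have "(LINT w|disc_area. ?i w) =
          (LINT w|disc_area. 2 * (complex_of_real (g w) / (1 - v * cnj w))) - (LINT w|disc_area. complex_of_real (g w))"
        by (intro Bochner_Integration.integral_diff integrable_mult_right Hint v gcint)
      then have "F v = (LINT w|disc_area. ?i w)"
        unfolding F_def H0 unfolding H_def cauchy_transform_def G_def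
        by (simp only: integral_mult_right_zero integral_complex_of_real)
      then have 1: "Re (F v) = (LINT w|disc_area. Re (?i w))"
        using integral_Re[OF i] by simp
      have 2: "Re (?i w) = g w * poisson (v * cnj w)" if "w \<in> space disc_area" for w
      proof -
        have "1 - v * cnj w \<noteq> 0"
          using that by (intro one_minus_nonzero norm_mult_cnj_less_1 v) simp
        then have "?i w = complex_of_real (g w) * ((1 + v * cnj w) / (1 - v * cnj w))"
          by (simp add: divide_simps) (simp add: algebra_simps)
        then show ?thesis by (simp only: poisson_def times_complex.sel Re_complex_of_real Im_complex_of_real mult_zero_left diff_zero)
      qed
      show "Re (F v) = (LINT w|disc_area. g w * poisson (v * cnj w))"
        unfolding 1 by (intro Bochner_Integration.integral_cong 2 refl)
      show "integrable disc_area (\<lambda>w. g w * poisson (v * cnj w))"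
        by (rule Bochner_Integration.integrable_cong[THEN iffD1, OF refl 2 integrable_Re[OF i]])
    qed
    show "(\<integral>\<^sup>+\<zeta>. ennreal (norm (cauchy_transform (\<lambda>w. complex_of_real (defect w powr b * \<phi> w)) (z * \<zeta>)) powr r) \<partial>circle_measure)
        \<le> ennreal (K * L powr r)"
    proof (cases "G = 0")
      \<comment> \<open>A vanishing total mass is excluded because then \<open>Re (F v)\<close> is
        0, not positive; here the density is null and \<open>H\<close> vanishes identically.\<close>
      case True
      then have "AE w in disc_area. g w = 0"
        using g0 gint by (simp add: G_def integral_nonneg_eq_0_iff_AE)
      then have "H v = 0" for v
        unfolding H_def cauchy_transform_def
        by (intro integral_eq_zero_AE) (auto elim!: eventually_mono)
      then show ?thesis using K r
        by (simp flip: g_def H_def)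
    next
      case False
      with G0 have Gp: "0 < G" by simp
      \<comment> \<open>The Harnack bound, uniform in \<open>w\<close>, makes the real part at least
        a positive multiple of the total mass \<open>G\<close>.\<close>
      have Fpos: "0 < Re (F v)" if v: "norm v < 1" for v
      proof -
        have "(1 - norm v) / 2 * G = (LINT w|disc_area. (1 - norm v) / 2 * g w)" by (simp add: G_def)
        also have "\<dots> \<le> (LINT w|disc_area. g w * poisson (v * cnj w))"
        proof (intro integral_mono integrable_mult_right gint ReF_int v)
          fix w assume "w \<in> space disc_area"
          then have w: "norm (v * cnj w) < 1" "norm (v * cnj w) \<le> norm v"
            using v norm_mult_cnj_less_1[of v w] mult_left_mono[of "norm w" 1 "norm v"] by (auto simp: norm_mult)
          have "(1 - norm v) / 2 \<le> poisson (v * cnj w)"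
            by (rule order_trans[OF divide_right_mono poisson_lower[OF w(1)]]) (use w(2) in auto)
          then show "(1 - norm v) / 2 * g w \<le> g w * poisson (v * cnj w)"
            using g0[of w] mult_right_mono by (metis mult.commute)
        qed
        finally have "(1 - norm v) / 2 * G \<le> Re (F v)" by (simp add: ReF[OF v])
        moreover have "0 < (1 - norm v) / 2 * G" using v Gp by simp
        ultimately show ?thesis by linarith
      qed
      have "(\<integral>\<^sup>+\<zeta>. ennreal (Re (F (z * \<zeta>)) powr r) \<partial>circle_measure) =
          (\<integral>\<^sup>+\<zeta>. ennreal ((LINT w|disc_area. defect w powr b * \<phi> w * poisson (z * \<zeta> * cnj w)) powr r) \<partial>circle_measure)"
        by (intro nn_integral_cong_AE, use AE_circle_measure in eventually_elim)
           (use z in \<open>simp add: ReF norm_mult g_def\<close>)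
      also have "\<dots> \<le> ennreal ((D * L) powr r)"
        unfolding D_def by (rule poisson_integral_power_bound[OF b r(1,2) z f \<phi> \<phi>0 \<phi>f L0 L])
      finally have "(\<integral>\<^sup>+\<zeta>. ennreal (Re (F (z * \<zeta>)) powr r) \<partial>circle_measure) \<le> ennreal ((D * L) powr r)" .
      moreover have "F holomorphic_on ball 0 1"
        unfolding F_def by (intro holomorphic_intros Hhol)
      moreover have "F \<in> borel_measurable borel"
        unfolding F_def by measurable
      ultimately have "(\<integral>\<^sup>+\<zeta>. ennreal (norm (F (z * \<zeta>)) powr r) \<partial>circle_measure) \<le> ennreal (A * (D * L) powr r + \<bar>B\<bar> * norm (F 0) powr r)"
        by (intro riesz_mean[OF A pt]) (auto intro: Fpos z)
      also have "\<dots> = ennreal (A * (D * L) powr r + \<bar>B\<bar> * G powr r)"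
        using G0 by (simp add: F0)
      finally have Fr: "(\<integral>\<^sup>+\<zeta>. ennreal (norm (F (z * \<zeta>)) powr r) \<partial>circle_measure) \<le> ennreal (A * (D * L) powr r + \<bar>B\<bar> * G powr r)" .
      \<comment> \<open>\<open>H\<close> is the midpoint of \<open>F\<close> and \<open>G\<close>,
        so its modulus is at most the larger of the two and no further constant arises.\<close>
      have pw: "norm (H v) powr r \<le> norm (F v) powr r + G powr r" for v
      proof -
        have "2 * norm (H v) = norm (F v + complex_of_real G)" by (simp add: F_def H0 norm_mult)
        also have "\<dots> \<le> norm (F v) + G" using norm_triangle_ineq[of "F v" "complex_of_real G"] G0 by simp
        finally have "norm (H v) \<le> max (norm (F v)) G" by (auto simp: max_def)
        then have "norm (H v) powr r \<le> max (norm (F v)) G powr r" using r by (intro powr_mono2) auto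
        also have "\<dots> \<le> norm (F v) powr r + G powr r" by (auto simp: max_def)
        finally show ?thesis .
      qed
      have [measurable]: "F \<in> borel_measurable borel" unfolding F_def by measurable
      have "(\<integral>\<^sup>+\<zeta>. ennreal (norm (H (z * \<zeta>)) powr r) \<partial>circle_measure) \<le>
         (\<integral>\<^sup>+\<zeta>. ennreal (norm (F (z * \<zeta>)) powr r) + ennreal (G powr r) \<partial>circle_measure)"
        using pw by (intro nn_integral_mono) (auto simp flip: ennreal_plus intro!: ennreal_leI)
      also have "\<dots> = (\<integral>\<^sup>+\<zeta>. ennreal (norm (F (z * \<zeta>)) powr r) \<partial>circle_measure) + ennreal (G powr r)"
        by (simp add: nn_integral_add emeasure_space_circle_measure)
      also have "\<dots> \<le> ennreal (A * (D * L) powr r + \<bar>B\<bar> * G powr r) + ennreal (G powr r)"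
        by (intro add_mono Fr order_refl)
      also have "\<dots> = ennreal (A * (D * L) powr r + (\<bar>B\<bar> + 1) * G powr r)"
        using A by (subst ennreal_plus[symmetric]) (auto simp: distrib_right)
      also have "\<dots> \<le> ennreal (A * (D * L) powr r + (\<bar>B\<bar> + 1) * (E * L) powr r)"
        using GE G0 r by (intro ennreal_leI add_left_mono mult_left_mono powr_mono2) auto
      also have "A * (D * L) powr r + (\<bar>B\<bar> + 1) * (E * L) powr r = K * L powr r"
        using D E L0 by (simp add: K_def powr_mult algebra_simps)
      finally show ?thesis by (simp add: H_def g_def)
    qed
  qed
qed

text \<open>The transform is linear, and the positive and negative parts of \<open>Re f\<close> and
  \<open>Im f\<close> are all dominated by \<open>norm f\<close>; the nonnegative case applies to
  each with the same \<open>L\<close>.\<close>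

lemma cauchy_transform_mean:
  fixes b r :: real
  assumes b: "-1 < b" "b < 0" and r: "1 < r" "r * (b + 1) < 1" "cos (r * (pi / 2)) \<noteq> 0"
  obtains K where "0 \<le> K" "\<And>f L z. \<lbrakk>f \<in> borel_measurable disc_area; 0 < L;
      (\<integral>\<^sup>+t\<in>{0<..}. ennreal (measure disc_area (superlevel f t) powr (b + 1)) \<partial>lborel) \<le> ennreal L; norm z < 1\<rbrakk> \<Longrightarrow>
      (\<integral>\<^sup>+\<zeta>. ennreal (norm (cauchy_transform (\<lambda>w. complex_of_real (defect w powr b) * f w) (z * \<zeta>)) powr r) \<partial>circle_measure)
        \<le> ennreal (K * L powr r)"
proof -
  note [measurable] = borel_measurable_weight
  obtain K where K: "0 \<le> K" and bd: "\<And>f \<phi> L z. \<lbrakk>f \<in> borel_measurable disc_area; \<phi> \<in> borel_measurable disc_area;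
      \<And>w. 0 \<le> \<phi> w; \<And>w. \<phi> w \<le> norm (f w); 0 < L;
      (\<integral>\<^sup>+t\<in>{0<..}. ennreal (measure disc_area (superlevel f t) powr (b + 1)) \<partial>lborel) \<le> ennreal L; norm z < 1\<rbrakk> \<Longrightarrow>
      (\<integral>\<^sup>+\<zeta>. ennreal (norm (cauchy_transform (\<lambda>w. complex_of_real (defect w powr b * \<phi> w)) (z * \<zeta>)) powr r) \<partial>circle_measure)
        \<le> ennreal (K * L powr r)"
    using cauchy_transform_mean_nonneg[OF b r] by blast
  show ?thesis
  proof (rule that)
    \<comment> \<open>One factor \<open>2 powr r\<close> separates real from imaginary
      contributions, the inner ones separate positive from negative parts.\<close>
    show "0 \<le> 2 powr r * (2 powr r * (K + K) + 2 powr r * (K + K))" using K by simp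
    fix f :: "complex \<Rightarrow> complex" and L :: real and z :: complex
    assume f[measurable]: "f \<in> borel_measurable disc_area" and L0: "0 < L"
      and L: "(\<integral>\<^sup>+t\<in>{0<..}. ennreal (measure disc_area (superlevel f t) powr (b + 1)) \<partial>lborel) \<le> ennreal L"
      and z: "norm z < 1"
    define H where "H \<phi> = cauchy_transform (\<lambda>w. complex_of_real (defect w powr b * \<phi> w))" for \<phi> :: "complex \<Rightarrow> real"
    define p1 p2 p3 p4 :: "complex \<Rightarrow> real" where
      "p1 w = max 0 (Re (f w))" and "p2 w = max 0 (- Re (f w))" and
      "p3 w = max 0 (Im (f w))" and "p4 w = max 0 (- Im (f w))" for w
    have pm[measurable]: "p1 \<in> borel_measurable disc_area" "p2 \<in> borel_measurable disc_area"
       "p3 \<in> borel_measurable disc_area" "p4 \<in> borel_measurable disc_area"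
      unfolding p1_def p2_def p3_def p4_def by measurable
    have p0: "0 \<le> p1 w" "0 \<le> p2 w" "0 \<le> p3 w" "0 \<le> p4 w" for w
      by (simp_all add: p1_def p2_def p3_def p4_def)
    have pf: "p1 w \<le> norm (f w)" "p2 w \<le> norm (f w)" "p3 w \<le> norm (f w)" "p4 w \<le> norm (f w)" for w
      using abs_Re_le_cmod[of "f w"] abs_Im_le_cmod[of "f w"] by (auto simp: p1_def p2_def p3_def p4_def)
    have f_eq: "f w = complex_of_real (p1 w) - complex_of_real (p2 w) + \<i> * (complex_of_real (p3 w) - complex_of_real (p4 w))" for w
      by (auto simp: complex_eq_iff p1_def p2_def p3_def p4_def max_def)
    have gint: "integrable disc_area (\<lambda>w. complex_of_real (defect w powr b * \<phi> w))"
      if [measurable]: "\<phi> \<in> borel_measurable disc_area" and "\<And>w. 0 \<le> \<phi> w" and "\<And>w. \<phi> w \<le> norm (f w)" for \<phi>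
    proof (rule integrableI_bounded)
      have "(\<integral>\<^sup>+w. ennreal (norm (complex_of_real (defect w powr b * \<phi> w))) \<partial>disc_area) \<le>
          (\<integral>\<^sup>+w. ennreal (defect w powr b * norm (f w)) \<partial>disc_area)"
        using that(2,3) by (intro nn_integral_mono ennreal_leI) (auto simp: norm_mult intro!: mult_left_mono)
      also have "\<dots> < \<infinity>"
        by (rule order.strict_trans1[OF weighted_integral_bound[OF b f L]]) simp
      finally show "(\<integral>\<^sup>+w. ennreal (norm (complex_of_real (defect w powr b * \<phi> w))) \<partial>disc_area) < \<infinity>" .
    qed measurable
    note gi = gint[OF pm(1) p0(1) pf(1)] gint[OF pm(2) p0(2) pf(2)] gint[OF pm(3) p0(3) pf(3)] gint[OF pm(4) p0(4) pf(4)]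
    have split: "cauchy_transform (\<lambda>w. complex_of_real (defect w powr b) * f w) v = H p1 v - H p2 v + \<i> * (H p3 v - H p4 v)"
      if v: "norm v < 1" for v
    proof -
      note ci = gi[THEN cauchy_transform_integrable, OF v]
      have "complex_of_real (defect w powr b) * f w / (1 - v * cnj w) =
          complex_of_real (defect w powr b * p1 w) / (1 - v * cnj w) - complex_of_real (defect w powr b * p2 w) / (1 - v * cnj w)
          + \<i> * (complex_of_real (defect w powr b * p3 w) / (1 - v * cnj w) - complex_of_real (defect w powr b * p4 w) / (1 - v * cnj w))" for w
        by (subst f_eq) (simp add: algebra_simps add_divide_distrib diff_divide_distrib)
      then show ?thesis
        unfolding cauchy_transform_def H_def using ci
        by (simp only: Bochner_Integration.integral_add Bochner_Integration.integral_diff integral_mult_right_zero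
            Bochner_Integration.integrable_diff integrable_mult_right)
    qed
    define N where "N \<phi> \<zeta> = norm (H \<phi> (z * \<zeta>)) powr r" for \<phi> \<zeta>
    have Nm: "N \<phi> \<in> borel_measurable circle_measure" if [measurable]: "\<phi> \<in> borel_measurable disc_area" for \<phi>
    proof -
      have [measurable]: "H \<phi> \<in> borel_measurable borel"
        unfolding H_def by (rule borel_measurable_cauchy_transform) measurable
      show ?thesis unfolding N_def by measurable
    qed
    note [measurable] = Nm[OF pm(1)] Nm[OF pm(2)] Nm[OF pm(3)] Nm[OF pm(4)]
    have N0: "0 \<le> N \<phi> \<zeta>" for \<phi> \<zeta> by (simp add: N_def)
    have pw: "norm (cauchy_transform (\<lambda>w. complex_of_real (defect w powr b) * f w) (z * \<zeta>)) powr r \<le>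
        2 powr r * (2 powr r * (N p1 \<zeta> + N p2 \<zeta>) + 2 powr r * (N p3 \<zeta> + N p4 \<zeta>))" if "norm \<zeta> = 1" for \<zeta>
    proof -
      have rp: "0 < r" using r by simp
      have v: "norm (z * \<zeta>) < 1" using z that by (simp add: norm_mult)
      let ?h = "\<lambda>\<phi>. norm (H \<phi> (z * \<zeta>))"
      have two: "norm (x - y) powr r \<le> 2 powr r * (norm x powr r + norm y powr r)" for x y :: complex
        using powr_mono2[OF less_imp_le[OF rp] norm_ge_zero norm_triangle_ineq4[of x y]] powr_add_le[of "norm x" "norm y" r] rp
        by simp
      have "norm (cauchy_transform (\<lambda>w. complex_of_real (defect w powr b) * f w) (z * \<zeta>)) \<le>
          norm (H p1 (z * \<zeta>) - H p2 (z * \<zeta>)) + norm (H p3 (z * \<zeta>) - H p4 (z * \<zeta>))"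
        unfolding split[OF v] using norm_triangle_ineq[of "H p1 (z * \<zeta>) - H p2 (z * \<zeta>)" "\<i> * (H p3 (z * \<zeta>) - H p4 (z * \<zeta>))"]
        by (simp add: norm_mult)
      then have "norm (cauchy_transform (\<lambda>w. complex_of_real (defect w powr b) * f w) (z * \<zeta>)) powr r \<le>
          (norm (H p1 (z * \<zeta>) - H p2 (z * \<zeta>)) + norm (H p3 (z * \<zeta>) - H p4 (z * \<zeta>))) powr r"
        using rp by (intro powr_mono2) auto
      also have "\<dots> \<le> 2 powr r * (norm (H p1 (z * \<zeta>) - H p2 (z * \<zeta>)) powr r + norm (H p3 (z * \<zeta>) - H p4 (z * \<zeta>)) powr r)"
        by (intro powr_add_le rp) auto
      also have "\<dots> \<le> 2 powr r * (2 powr r * (N p1 \<zeta> + N p2 \<zeta>) + 2 powr r * (N p3 \<zeta> + N p4 \<zeta>))"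
        unfolding N_def by (intro mult_left_mono add_mono two) auto
      finally show ?thesis .
    qed
    have Nb: "(\<integral>\<^sup>+\<zeta>. ennreal (N \<phi> \<zeta>) \<partial>circle_measure) \<le> ennreal (K * L powr r)"
      if "\<phi> \<in> borel_measurable disc_area" "\<And>w. 0 \<le> \<phi> w" "\<And>w. \<phi> w \<le> norm (f w)" for \<phi>
      unfolding N_def H_def by (rule bd[OF f that L0 L z])
    let ?c = "ennreal (2 powr r)"
    have "(\<integral>\<^sup>+\<zeta>. ennreal (norm (cauchy_transform (\<lambda>w. complex_of_real (defect w powr b) * f w) (z * \<zeta>)) powr r) \<partial>circle_measure) \<le>
        (\<integral>\<^sup>+\<zeta>. ?c * (?c * (ennreal (N p1 \<zeta>) + ennreal (N p2 \<zeta>)) + ?c * (ennreal (N p3 \<zeta>) + ennreal (N p4 \<zeta>))) \<partial>circle_measure)"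
    proof (intro nn_integral_mono_AE, use AE_circle_measure in eventually_elim)
      case (elim \<zeta>)
      then show ?case
        using ennreal_leI[OF pw[OF elim]] N0 by (simp add: ennreal_mult' ennreal_plus)
    qed
    also have "\<dots> = ?c * (?c * ((\<integral>\<^sup>+\<zeta>. ennreal (N p1 \<zeta>) \<partial>circle_measure) + (\<integral>\<^sup>+\<zeta>. ennreal (N p2 \<zeta>) \<partial>circle_measure))
       + ?c * ((\<integral>\<^sup>+\<zeta>. ennreal (N p3 \<zeta>) \<partial>circle_measure) + (\<integral>\<^sup>+\<zeta>. ennreal (N p4 \<zeta>) \<partial>circle_measure)))"
      by (simp add: nn_integral_cmult nn_integral_add)
    also have "\<dots> \<le> ?c * (?c * (ennreal (K * L powr r) + ennreal (K * L powr r)) + ?c * (ennreal (K * L powr r) + ennreal (K * L powr r)))"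
      by (intro mult_left_mono add_mono Nb pm p0 pf) auto
    also have "\<dots> = ennreal ((2 powr r * (2 powr r * (K + K) + 2 powr r * (K + K))) * L powr r)"
      using K by (simp add: ennreal_mult'[symmetric] ennreal_plus[symmetric] algebra_simps del: ennreal_plus)
    finally show "(\<integral>\<^sup>+\<zeta>. ennreal (norm (cauchy_transform (\<lambda>w. complex_of_real (defect w powr b) * f w) (z * \<zeta>)) powr r) \<partial>circle_measure)
        \<le> ennreal ((2 powr r * (2 powr r * (K + K) + 2 powr r * (K + K))) * L powr r)" .
  qed
qed

subsection \<open>The weak-type bound\<close>

text \<open>The part of the level set within defect \<open>\<eta>\<close> has area at most
  \<open>\<eta>\<close>. On the rest, Chebyshev at exponent \<open>r\<close> and the uniform circle
  means leave the integral of \<open>x powr (a * r)\<close> beyond \<open>\<eta>\<close>, which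
  converges at infinity as \<open>a * r < -1\<close>.\<close>

lemma weak_level_bound:
  fixes a r K L t :: real and H :: "complex \<Rightarrow> complex"
  assumes a: "a < 0" and r: "0 < r" "a * r < -1" and K: "0 \<le> K" and L: "0 < L" and t: "0 < t"
    and [measurable]: "H \<in> borel_measurable borel"
    and mean: "\<And>z. norm z < 1 \<Longrightarrow> (\<integral>\<^sup>+\<zeta>. ennreal (norm (H (z * \<zeta>)) powr r) \<partial>circle_measure) \<le> ennreal (K * L powr r)"
  shows "t * measure disc_area {z \<in> space disc_area. t < defect z powr a * norm (H z)} powr (- a)
    \<le> (1 + K / (- (a * r) - 1)) powr (- a) * L"
proof -
  let ?S = "{z \<in> space disc_area. t < defect z powr a * norm (H z)}"
  \<comment> \<open>The depth at which \<open>\<eta> powr a * L\<close> equals the level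
    \<open>t\<close>; it makes both areas comparable to \<open>\<eta>\<close>.\<close>
  define \<eta> where "\<eta> = (L / t) powr (- 1 / a)"
  define M where "M = 1 + K / (- (a * r) - 1)"
  have M: "0 < M" using K r by (auto simp: M_def intro!: add_pos_nonneg)
  have \<eta>: "0 < \<eta>" using L t by (simp add: \<eta>_def)
  have \<eta>a: "\<eta> powr (- a) = L / t" using a L t by (simp add: \<eta>_def powr_powr)
  then have \<eta>r: "\<eta> powr (a * r) = (L / t) powr (- r)"
    by (metis minus_mult_minus powr_powr)
  let ?w = "\<lambda>x. ennreal (x powr (a * r)) * indicator {\<eta>..} x"
  have m1: "(\<lambda>z. indicator {0..\<eta>} (defect z) :: ennreal) \<in> borel_measurable disc_area"
    and m2: "(\<lambda>z. ?w (defect z) * ennreal (norm (H z) powr r)) \<in> borel_measurable disc_area"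
    and m3: "(\<lambda>z. ?w (defect z)) \<in> borel_measurable disc_area"
    and m4: "(\<lambda>z. defect z powr a * norm (H z)) \<in> borel_measurable disc_area"
    by (intro borel_measurable_disc_area; measurable)+
  note [measurable] = m1 m2 m3 m4
  have S: "?S \<in> sets disc_area" by measurable
  have "ennreal (measure disc_area ?S) = (\<integral>\<^sup>+z. indicator ?S z \<partial>disc_area)"
    using S by (simp add: disc.emeasure_eq_measure)
  also have "\<dots> \<le> (\<integral>\<^sup>+z. indicator {0..\<eta>} (defect z) + ennreal (t powr (- r)) * (?w (defect z) * ennreal (norm (H z) powr r)) \<partial>disc_area)"
  proof (rule nn_integral_mono)
    fix z assume "z \<in> space disc_area"
    then have s: "0 < defect z" by (simp add: defect_pos)
    show "indicator ?S z \<le> indicator {0..\<eta>} (defect z) + ennreal (t powr (- r)) * (?w (defect z) * ennreal (norm (H z) powr r))"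
    proof (cases "z \<in> ?S \<and> \<eta> < defect z")
      case True
      then have "t powr r \<le> (defect z powr a * norm (H z)) powr r"
        using t r by (intro powr_mono2) auto
      also have "\<dots> = defect z powr (a * r) * norm (H z) powr r"
        using s by (simp add: powr_mult powr_powr)
      finally have "t powr (- r) * t powr r \<le> t powr (- r) * (defect z powr (a * r) * norm (H z) powr r)"
        by (intro mult_left_mono) auto
      moreover have "t powr (- r) * t powr r = 1" using t by (simp flip: powr_add)
      ultimately have "1 \<le> ennreal (t powr (- r) * (defect z powr (a * r) * norm (H z) powr r))"
        by (simp add: ennreal_leI flip: ennreal_1)
      then show ?thesis using True by (simp add: ennreal_mult')
    next
      case False
      then show ?thesis using s by (auto split: split_indicator)
    qed
  qed
  also have "\<dots> = (\<integral>\<^sup>+z. indicator {0..\<eta>} (defect z) \<partial>disc_area) +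
      ennreal (t powr (- r)) * (\<integral>\<^sup>+z. ?w (defect z) * ennreal (norm (H z) powr r) \<partial>disc_area)"
    by (simp add: nn_integral_add nn_integral_cmult)
  also have "\<dots> \<le> ennreal \<eta> + ennreal (t powr (- r)) * (ennreal (K * L powr r) * ennreal (\<eta> powr (a * r + 1) / (- (a * r) - 1)))"
  proof (intro add_mono mult_left_mono)
    have "(\<integral>\<^sup>+z. indicator {0..\<eta>} (defect z) \<partial>disc_area) \<le> (\<integral>\<^sup>+z. ennreal (defect z powr 0) * indicator {0..\<eta>} (defect z) \<partial>disc_area)"
      using defect_pos by (intro nn_integral_mono) (fastforce split: split_indicator)
    also have "\<dots> \<le> ennreal \<eta>" using nn_integral_defect_near[of 0 \<eta>] \<eta> by simp
    finally show "(\<integral>\<^sup>+z. indicator {0..\<eta>} (defect z) \<partial>disc_area) \<le> ennreal \<eta>" .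
    have "(\<integral>\<^sup>+z. ?w (defect z) * ennreal (norm (H z) powr r) \<partial>disc_area) =
        (\<integral>\<^sup>+z. \<integral>\<^sup>+\<zeta>. ?w (defect (z * \<zeta>)) * ennreal (norm (H (z * \<zeta>)) powr r) \<partial>circle_measure \<partial>disc_area)"
      by (rule nn_integral_disc_area_polar) measurable
    also have "\<dots> \<le> (\<integral>\<^sup>+z. ennreal (K * L powr r) * ?w (defect z) \<partial>disc_area)"
    proof (rule nn_integral_mono)
      fix z assume z: "z \<in> space disc_area"
      have "(\<integral>\<^sup>+\<zeta>. ?w (defect (z * \<zeta>)) * ennreal (norm (H (z * \<zeta>)) powr r) \<partial>circle_measure) =
          (\<integral>\<^sup>+\<zeta>. ?w (defect z) * ennreal (norm (H (z * \<zeta>)) powr r) \<partial>circle_measure)"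
        by (intro nn_integral_cong_AE, use AE_circle_measure in eventually_elim) (simp add: defect_mult_circle)
      also have "\<dots> = ?w (defect z) * (\<integral>\<^sup>+\<zeta>. ennreal (norm (H (z * \<zeta>)) powr r) \<partial>circle_measure)"
        by (rule nn_integral_cmult) measurable
      also have "\<dots> \<le> ?w (defect z) * ennreal (K * L powr r)"
        using mean[of z] z by (intro mult_left_mono) auto
      finally show "(\<integral>\<^sup>+\<zeta>. ?w (defect (z * \<zeta>)) * ennreal (norm (H (z * \<zeta>)) powr r) \<partial>circle_measure) \<le> ennreal (K * L powr r) * ?w (defect z)"
        by (simp add: mult.commute)
    qed
    also have "\<dots> = ennreal (K * L powr r) * (\<integral>\<^sup>+z. ?w (defect z) \<partial>disc_area)"
      by (rule nn_integral_cmult) measurable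
    also have "\<dots> \<le> ennreal (K * L powr r) * ennreal (\<eta> powr (a * r + 1) / (- (a * r) - 1))"
      using nn_integral_defect_far[of "a * r" \<eta>] r \<eta> by (intro mult_left_mono) auto
    finally show "(\<integral>\<^sup>+z. ?w (defect z) * ennreal (norm (H z) powr r) \<partial>disc_area) \<le> ennreal (K * L powr r) * ennreal (\<eta> powr (a * r + 1) / (- (a * r) - 1))" .
  qed simp
  also have "\<dots> = ennreal (\<eta> + t powr (- r) * (K * L powr r * (\<eta> powr (a * r + 1) / (- (a * r) - 1))))"
    using \<eta> K r by (subst ennreal_plus) (auto simp: mult_nonneg_nonneg divide_nonneg_nonneg simp flip: ennreal_mult')
  also have "\<eta> + t powr (- r) * (K * L powr r * (\<eta> powr (a * r + 1) / (- (a * r) - 1))) = M * \<eta>"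
  proof -
    have "t powr (- r) * L powr r * \<eta> powr (a * r) = 1"
    proof -
      have "t powr (- r) * L powr r = (L / t) powr r"
        using L t by (simp add: powr_divide powr_minus field_simps)
      then show ?thesis using L t by (simp add: \<eta>r flip: powr_add)
    qed
    then have "t powr (- r) * (K * L powr r * (\<eta> powr (a * r + 1) / (- (a * r) - 1))) = K / (- (a * r) - 1) * \<eta>"
      using \<eta> by (simp add: powr_add mult_ac)
    then show ?thesis by (simp add: M_def distrib_right)
  qed
  finally have "measure disc_area ?S \<le> M * \<eta>"
    using M \<eta> by simp
  then have "t * measure disc_area ?S powr (- a) \<le> t * (M * \<eta>) powr (- a)"
    using a t by (intro mult_left_mono powr_mono2) auto
  also have "\<dots> = M powr (- a) * L"
    using M \<eta> t by (simp add: powr_mult \<eta>a)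
  finally show ?thesis by (simp add: M_def)
qed

lemma weighted_op_T_kernel:
  assumes "norm z < 1"
  shows "weighted_op a (T_kernel b 1) f z =
    complex_of_real (defect z powr a) * cauchy_transform (\<lambda>w. complex_of_real (defect w powr b) * f w) z"
  by (simp add: weighted_op_def T_kernel_def cauchy_transform_def defect_def)

lemma T_bounded_critical:
  fixes a b :: real
  assumes a: "-1 < a" and b: "-1 < b" and ab: "a + b < -1"
  shows "T_bounded a b 1 (lorentz1_norm (1 / (b + 1))) (weak_norm (- (1 / a)))"
proof -
  note [measurable] = borel_measurable_weight
  have a0: "a < 0" and b0: "b < 0" using assms by linarith+
  \<comment> \<open>between \<open>- 1 / a\<close> and \<open>1 / (b + 1)\<close>, and not an integer\<close>
  define r where "r = (let q = - (1 / a) in (q + min (1 / (b + 1)) (of_int \<lfloor>q\<rfloor> + 1)) / 2)"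
  have qp: "- (1 / a) < 1 / (b + 1)"
    using a0 b ab by (simp add: field_simps)
  have r: "- (1 / a) < r" "r < 1 / (b + 1)" "r < of_int \<lfloor>- (1 / a)\<rfloor> + 1"
    using qp floor_correct[of "- (1 / a)"] by (auto simp: r_def Let_def min_def field_simps)
  have r1: "1 < r"
  proof -
    have "1 < - (1 / a)" using a a0 by (simp add: field_simps)
    then show ?thesis using r by linarith
  qed
  have ar: "a * r < -1" using r(1) a0 by (simp add: field_simps)
  have rb: "r * (b + 1) < 1" using r(2) b by (simp add: field_simps)
  have "cos (r * (pi / 2)) \<noteq> 0"
  proof
    assume "cos (r * (pi / 2)) = 0"
    then obtain i :: int where "r * (pi / 2) = of_int i * (pi / 2)"
      unfolding cos_zero_iff_int by blast
    then have ri: "r = of_int i" by simp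
    have "\<lfloor>- (1 / a)\<rfloor> < i"
      using r(1) floor_correct[of "- (1 / a)"] unfolding ri by linarith
    moreover have "i < \<lfloor>- (1 / a)\<rfloor> + 1" using r(3) unfolding ri by linarith
    ultimately show False by linarith
  qed
  with b b0 r1 rb obtain K where K: "0 \<le> K" and mean: "\<And>f L z. \<lbrakk>f \<in> borel_measurable disc_area; 0 < L;
      (\<integral>\<^sup>+t\<in>{0<..}. ennreal (measure disc_area (superlevel f t) powr (b + 1)) \<partial>lborel) \<le> ennreal L; norm z < 1\<rbrakk> \<Longrightarrow>
      (\<integral>\<^sup>+\<zeta>. ennreal (norm (cauchy_transform (\<lambda>w. complex_of_real (defect w powr b) * f w) (z * \<zeta>)) powr r) \<partial>circle_measure)
        \<le> ennreal (K * L powr r)"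
    using cauchy_transform_mean[of b r] by blast
  define C where "C = (1 + K / (- (a * r) - 1)) powr (- a)"
  have "0 < 1 + K / (- (a * r) - 1)" using K ar by (intro add_pos_nonneg) auto
  then have C: "0 < C" by (simp add: C_def)
  \<comment> \<open>The factor \<open>b + 1\<close> cancels the \<open>p = 1 / (b + 1)\<close> built
    into \<open>lorentz1_norm\<close>.\<close>
  have "(AE z in disc_area. integrable disc_area (\<lambda>w. T_kernel b 1 z w * f w)) \<and>
      weighted_op a (T_kernel b 1) f \<in> function_space (weak_norm (- (1 / a))) \<and>
      weak_norm (- (1 / a)) (weighted_op a (T_kernel b 1) f) \<le> ennreal (C * (b + 1)) * lorentz1_norm (1 / (b + 1)) f"
    if f: "f \<in> function_space (lorentz1_norm (1 / (b + 1)))" for f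
  proof -
    let ?I = "\<integral>\<^sup>+t\<in>{0<..}. ennreal (measure disc_area (superlevel f t) powr (b + 1)) \<partial>lborel"
    have fm[measurable]: "f \<in> borel_measurable disc_area" using f by (simp add: function_space_def)
    have N: "lorentz1_norm (1 / (b + 1)) f = ennreal (1 / (b + 1)) * ?I"
      by (simp add: lorentz1_norm_def)
    have "ennreal (1 / (b + 1)) * ?I < \<infinity>"
      using f N by (simp add: function_space_def)
    moreover have "ennreal (1 / (b + 1)) \<noteq> 0" using b by (simp add: ennreal_eq_0_iff)
    ultimately have "?I \<noteq> \<infinity>" by (auto simp: ennreal_mult_top)
    then obtain i where i: "?I = ennreal i" "0 \<le> i" by (cases ?I) auto
    define g where "g w = complex_of_real (defect w powr b) * f w" for w
    have [measurable]: "g \<in> borel_measurable disc_area" unfolding g_def by measurable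
    have gint: "integrable disc_area g"
    proof (rule integrableI_bounded)
      have "(\<integral>\<^sup>+w. ennreal (norm (g w)) \<partial>disc_area) \<le> ennreal ((1 / (b + 1) + 1) * i)"
        using weighted_integral_bound[OF b b0 fm, of i] i by (simp add: g_def norm_mult)
      then show "(\<integral>\<^sup>+w. ennreal (norm (g w)) \<partial>disc_area) < \<infinity>"
        by (rule order.strict_trans1) simp
    qed measurable
    define H where "H = cauchy_transform g"
    have Hm[measurable]: "H \<in> borel_measurable borel"
      unfolding H_def by (rule borel_measurable_cauchy_transform) measurable
    have [measurable]: "H \<in> borel_measurable disc_area" by (rule borel_measurable_disc_area) measurable
    let ?T = "weighted_op a (T_kernel b 1) f"
    have T_eq: "?T z = complex_of_real (defect z powr a) * H z" if "norm z < 1" for z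
      unfolding H_def g_def by (rule weighted_op_T_kernel[OF that])
    have "AE z in disc_area. integrable disc_area (\<lambda>w. T_kernel b 1 z w * f w)"
    proof (rule AE_I2)
      fix z assume "z \<in> space disc_area"
      then show "integrable disc_area (\<lambda>w. T_kernel b 1 z w * f w)"
        using cauchy_transform_integrable[OF gint, of z] by (simp add: T_kernel_def g_def defect_def)
    qed
    moreover have Tm: "?T \<in> borel_measurable disc_area"
    proof (subst measurable_cong)
      show "?T z = complex_of_real (defect z powr a) * H z" if "z \<in> space disc_area" for z
        using T_eq that by simp
    qed measurable
    moreover have weak: "weak_norm (- (1 / a)) ?T \<le> ennreal (C * i)"
    proof (rule ennreal_le_epsilon)
      fix e :: real assume e: "0 < e"
      \<comment> \<open>The mean estimate needs a positive bound, but \<open>i\<close> may be 0. The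
        excess costs exactly \<open>e\<close> in the weak norm, and \<open>e\<close> is
        arbitrary.\<close>
      define L where "L = i + e / C"
      have L: "0 < L" using i e C by (simp add: L_def add_nonneg_pos)
      have IL: "?I \<le> ennreal L" using i e C by (simp add: L_def)
      have "weak_norm (- (1 / a)) ?T \<le> ennreal (C * L)"
        unfolding weak_norm_def
      proof (rule SUP_least)
        fix t :: real assume "t \<in> {0<..}"
        then have t: "0 < t" by simp
        have sl: "superlevel ?T t = {z \<in> space disc_area. t < defect z powr a * norm (H z)}"
          unfolding superlevel_def using T_eq by (auto simp: norm_mult)
        have "t * measure disc_area (superlevel ?T t) powr (- a) \<le> C * L"
          unfolding sl C_def
          using mean[OF fm L IL] r1
          by (intro weak_level_bound a0 ar K L t Hm) (auto simp: H_def g_def[abs_def])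
        then show "ennreal (t * measure disc_area (superlevel ?T t) powr (1 / - (1 / a))) \<le> ennreal (C * L)"
          by (simp add: ennreal_leI)
      qed
      also have "C * L = C * i + e" using C by (simp add: L_def distrib_left)
      also have "ennreal (C * i + e) = ennreal (C * i) + ennreal e"
        using C i e by (intro ennreal_plus) auto
      finally show "weak_norm (- (1 / a)) ?T \<le> ennreal (C * i) + ennreal e" .
    qed
    moreover have "weak_norm (- (1 / a)) ?T < \<infinity>"
      using weak by (rule order.strict_trans1) simp
    moreover have "ennreal (C * (b + 1)) * lorentz1_norm (1 / (b + 1)) f = ennreal (C * i)"
      unfolding N i(1) using C b i(2) by (simp add: ennreal_mult'[symmetric])
    ultimately show ?thesis by (simp add: function_space_def)
  qed
  moreover have "0 \<le> C * (b + 1)" using C b by simp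
  ultimately show ?thesis
    unfolding T_bounded_def weighted_op_bounded_def by blast
qed

subsection \<open>The logarithm in the kernel with absolute values\<close>

text \<open>The source of the logarithm; the length \<open>1 / 2\<close> is what is always available
  on one side of a point of the unit interval.\<close>

lemma nn_integral_inverse_linear:
  assumes "0 < \<delta>"
  shows "(\<integral>\<^sup>+x. ennreal (1 / (\<delta> + 2 * pi * x)) * indicator {0..1/2} x \<partial>lborel) = ennreal (ln (1 + pi / \<delta>) / (2 * pi))"
proof -
  have pos: "0 < \<delta> + 2 * pi * x" if "0 \<le> x" for x
    using assms that by (intro add_pos_nonneg) auto
  have "((\<lambda>x. 1 / (\<delta> + 2 * pi * x)) has_integral (ln (\<delta> + 2 * pi * (1/2)) / (2 * pi) - ln (\<delta> + 2 * pi * 0) / (2 * pi))) {0..1/2}"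
    by (rule fundamental_theorem_of_calculus)
       (auto intro!: derivative_eq_intros pos simp flip: has_real_derivative_iff_has_vector_derivative)
  moreover have "ln (\<delta> + 2 * pi * (1/2)) / (2 * pi) - ln (\<delta> + 2 * pi * 0) / (2 * pi) = ln (1 + pi / \<delta>) / (2 * pi)"
  proof -
    have "1 + pi / \<delta> = (\<delta> + pi) / \<delta>" using assms by (simp add: field_simps)
    then have "ln (1 + pi / \<delta>) = ln (\<delta> + pi) - ln \<delta>"
      using assms add_pos_pos[OF assms pi_gt_zero] by (simp add: ln_div)
    then show ?thesis by (simp add: diff_divide_distrib)
  qed
  ultimately have "((\<lambda>x. 1 / (\<delta> + 2 * pi * x)) has_integral (ln (1 + pi / \<delta>) / (2 * pi))) {0..1/2}" by simp
  with pos show ?thesis by (intro nn_integral_has_integral_lebesgue') (auto simp: less_imp_le)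
qed

text \<open>The distance from 1 to \<open>u * \<zeta>\<close> is at most the radial gap
  \<open>1 - norm u\<close> plus the arc between the direction of \<open>u * \<zeta>\<close> and 1,
  and the reciprocal of this linear bound integrates to a logarithm.\<close>

lemma circle_mean_inverse_lower:
  assumes u: "norm u < 1" and \<delta>: "1 - norm u \<le> \<delta>"
  shows "ennreal (ln (1 + pi / \<delta>) / (2 * pi)) \<le> (\<integral>\<^sup>+\<zeta>. ennreal (1 / norm (1 - u * \<zeta>)) \<partial>circle_measure)"
proof -
  have \<delta>0: "0 < \<delta>" using u \<delta> by linarith
  \<comment> \<open>The parameter in the unit interval at which the rotated \<open>u\<close> is a
    nonnegative real, closest to 1.\<close>
  define \<tau> where "\<tau> = 1 - Arg2pi u / (2 * pi)"
  have \<tau>: "0 < \<tau>" "\<tau> \<le> 1"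
    using Arg2pi_lt_2pi[of u] Arg2pi_ge_0[of u] by (auto simp: \<tau>_def field_simps)
  have bound: "1 / (\<delta> + 2 * pi * \<bar>t - \<tau>\<bar>) \<le> 1 / norm (1 - u * exp (2 * pi * t * \<i>))" for t :: real
  proof -
    let ?e = "exp (\<i> * complex_of_real (2 * pi * (t - \<tau>)))"
    have Arg: "Arg2pi u = 2 * pi * (1 - \<tau>)" by (simp add: \<tau>_def)
    have angle: "\<i> * complex_of_real (Arg2pi u) + 2 * pi * t * \<i> = \<i> * complex_of_real (2 * pi * (t - \<tau>)) + 2 * pi * \<i>"
      unfolding Arg by (simp add: algebra_simps)
    have "exp (\<i> * complex_of_real (Arg2pi u)) * exp (2 * pi * t * \<i>) = ?e * exp (2 * pi * \<i>)"
      by (simp only: exp_add[symmetric] angle)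
    also have "exp (2 * pi * \<i>) = (1 :: complex)"
      using exp_two_pi_i by simp
    finally have "u * exp (2 * pi * t * \<i>) = complex_of_real (norm u) * ?e"
      by (subst Arg2pi_eq[of u]) (simp add: mult.assoc)
    then have "1 - u * exp (2 * pi * t * \<i>) = complex_of_real (1 - norm u) - complex_of_real (norm u) * (?e - 1)"
      by (simp add: algebra_simps)
    then have "norm (1 - u * exp (2 * pi * t * \<i>)) \<le> norm (complex_of_real (1 - norm u)) + norm (complex_of_real (norm u) * (?e - 1))"
      by (metis norm_triangle_ineq4)
    also have "\<dots> = (1 - norm u) + norm u * (2 * \<bar>sin (2 * pi * (t - \<tau>) / 2)\<bar>)"
      using u by (simp only: norm_mult dist_exp_i_1 norm_of_real) simp
    also have "\<dots> \<le> \<delta> + 1 * (2 * \<bar>2 * pi * (t - \<tau>) / 2\<bar>)"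
      using u \<delta> by (intro add_mono mult_mono abs_sin_x_le_abs_x) auto
    also have "\<dots> = \<delta> + 2 * pi * \<bar>t - \<tau>\<bar>" by (simp add: abs_mult)
    finally have le: "norm (1 - u * exp (2 * pi * t * \<i>)) \<le> \<delta> + 2 * pi * \<bar>t - \<tau>\<bar>" .
    have "norm (u * exp (2 * pi * t * \<i>)) < 1"
      using u by (simp add: norm_mult)
    then have "0 < norm (1 - u * exp (2 * pi * t * \<i>))"
      using one_minus_nonzero by simp
    then show ?thesis using le by (intro frac_le) auto
  qed
  \<comment> \<open>The direction in which an interval of length \<open>1 / 2\<close> starting at
    \<open>\<tau>\<close> stays inside the unit interval.\<close>
  define c :: real where "c = (if 1 / 2 \<le> \<tau> then -1 else 1)"
  have c: "c \<noteq> 0" "\<bar>c\<bar> = 1" by (auto simp: c_def)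
  have cx: "\<tau> + c * x \<in> {0..1}" if "x \<in> {0..1/2}" for x
    using that \<tau> by (auto simp: c_def)
  let ?F = "\<lambda>t::real. ennreal (1 / norm (1 - u * exp (2 * pi * t * \<i>))) * indicator {0..1} t"
  have "ennreal (ln (1 + pi / \<delta>) / (2 * pi)) = (\<integral>\<^sup>+x. ennreal (1 / (\<delta> + 2 * pi * x)) * indicator {0..1/2} x \<partial>lborel)"
    by (rule nn_integral_inverse_linear[OF \<delta>0, symmetric])
  also have "\<dots> \<le> (\<integral>\<^sup>+x. ?F (\<tau> + c * x) \<partial>lborel)"
  proof (rule nn_integral_mono)
    fix x :: real
    show "ennreal (1 / (\<delta> + 2 * pi * x)) * indicator {0..1/2} x \<le> ?F (\<tau> + c * x)"
    proof (cases "x \<in> {0..1/2}")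
      case True
      then have "\<bar>\<tau> + c * x - \<tau>\<bar> = x" using c by (simp add: abs_mult)
      then show ?thesis using True cx[OF True] bound[of "\<tau> + c * x"] by (simp add: ennreal_leI)
    qed simp
  qed
  also have "\<dots> = (\<integral>\<^sup>+t. ?F t \<partial>lborel)"
    using nn_integral_real_affine[of ?F c \<tau>] c by simp
  also have "\<dots> = (\<integral>\<^sup>+\<zeta>. ennreal (1 / norm (1 - u * \<zeta>)) \<partial>circle_measure)"
    by (rule nn_integral_circle_measure[symmetric]) measurable
  finally show ?thesis .
qed

text \<open>Also contains all points outside the disc, which \<open>disc_area\<close> ignores; this
  keeps the condition a single inequality on the defect and the set Borel in the plane.\<close>

definition annulus :: "real \<Rightarrow> complex set" where
  "annulus \<delta> = {w. defect w \<le> \<delta>}"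

lemma annulus_borel [measurable]: "annulus \<delta> \<in> sets borel"
  unfolding annulus_def by measurable

lemma nn_integral_annulus:
  assumes "0 < \<delta>" "\<delta> < 1"
  shows "(\<integral>\<^sup>+w. indicator (annulus \<delta>) w \<partial>disc_area) = ennreal \<delta>"
proof -
  have "(\<integral>\<^sup>+w. indicator {..\<delta>} (defect w) \<partial>disc_area) = (\<integral>\<^sup>+x. indicator {..\<delta>} x * indicator {0<..1} x \<partial>lborel)"
    by (rule nn_integral_defect) measurable
  also have "\<dots> = (\<integral>\<^sup>+x. indicator {0<..\<delta>} x \<partial>lborel)"
    using assms by (intro nn_integral_cong) (auto split: split_indicator)
  also have "\<dots> = ennreal \<delta>" using assms by simp
  finally show ?thesis by (simp add: annulus_def indicator_def)
qed

lemma measure_annulus: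
  assumes "0 < \<delta>" "\<delta> < 1"
  shows "annulus \<delta> \<inter> ball 0 1 \<in> sets disc_area" "measure disc_area (annulus \<delta> \<inter> ball 0 1) = \<delta>"
proof -
  show s: "annulus \<delta> \<inter> ball 0 1 \<in> sets disc_area"
    using measurable_sets[OF ident_measurable_disc_area annulus_borel[of \<delta>]] by simp
  have "emeasure disc_area (annulus \<delta> \<inter> ball 0 1) = (\<integral>\<^sup>+w. indicator (annulus \<delta> \<inter> ball 0 1) w \<partial>disc_area)"
    using s by simp
  also have "\<dots> = (\<integral>\<^sup>+w. indicator (annulus \<delta>) w \<partial>disc_area)"
    by (intro nn_integral_cong) (auto split: split_indicator)
  finally show "measure disc_area (annulus \<delta> \<inter> ball 0 1) = \<delta>"
    using assms by (simp add: nn_integral_annulus measure_def)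
qed

lemma lorentz1_norm_annulus:
  assumes "0 < \<delta>" "\<delta> < 1" "-1 < b"
  shows "lorentz1_norm (1 / (b + 1)) (indicator (annulus \<delta>)) = ennreal (\<delta> powr (b + 1) / (b + 1))"
proof -
  have sl: "superlevel (indicator (annulus \<delta>)) t = (if t < 1 then annulus \<delta> \<inter> ball 0 1 else {})" if "0 < t" for t
    using that by (auto simp: superlevel_def indicator_def)
  have "(\<integral>\<^sup>+t\<in>{0<..}. ennreal (measure disc_area (superlevel (indicator (annulus \<delta>)) t) powr (b + 1)) \<partial>lborel) =
      (\<integral>\<^sup>+t. ennreal (\<delta> powr (b + 1)) * indicator {0<..<1::real} t \<partial>lborel)"
    by (intro nn_integral_cong) (use sl measure_annulus[OF assms(1,2)] in \<open>auto split: split_indicator\<close>)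
  also have "\<dots> = ennreal (\<delta> powr (b + 1))" by (simp add: nn_integral_cmult)
  finally show ?thesis
    using assms by (simp add: lorentz1_norm_def ennreal_mult'[symmetric])
qed

text \<open>On the annulus, of area \<open>\<delta>\<close>, the weight is at least
  \<open>\<delta> powr b\<close> since \<open>b < 0\<close>. Averaging the kernel over rotations of
  \<open>w\<close> supplies the logarithm, as \<open>z\<close> and \<open>w\<close> both lie close
  to the circle.\<close>

lemma S_annulus_lower:
  assumes b: "-1 < b" "b < 0" and \<delta>: "0 < \<delta>" "\<delta> < 1" and z: "norm z < 1" "z \<in> annulus \<delta>"
  shows "defect z powr a * (ln (1 + pi / \<delta>) / (2 * pi) * \<delta> powr (b + 1))
    \<le> norm (weighted_op a (S_kernel b 1) (indicator (annulus \<delta>)) z)"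
proof -
  note [measurable] = borel_measurable_weight
  let ?l = "ln (1 + pi / \<delta>) / (2 * pi)"
  let ?k = "\<lambda>w. defect w powr b * indicator (annulus \<delta>) w / norm (1 - z * cnj w)"
  have l: "0 \<le> ?l" using \<delta> by (simp add: add_pos_pos)
  have am[measurable]: "(\<lambda>w. indicator (annulus \<delta>) w :: real) \<in> borel_measurable disc_area"
    by (rule borel_measurable_disc_area) measurable
  \<comment> \<open>Convergence is needed, since a divergent Bochner integral would be 0 and spoil
    the lower bound. It is inherited from the Cauchy kernel, which has the same modulus.\<close>
  have "integrable disc_area (\<lambda>w. complex_of_real (defect w powr b * indicator (annulus \<delta>) w))"
  proof (rule integrableI_bounded)
    have "(\<integral>\<^sup>+w. ennreal (norm (complex_of_real (defect w powr b * indicator (annulus \<delta>) w))) \<partial>disc_area) \<le>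
        (\<integral>\<^sup>+w. ennreal (defect w powr b) * indicator {0..1} (defect w) \<partial>disc_area)"
      using defect_pos defect_le_1
      by (intro nn_integral_mono) (fastforce simp: norm_mult split: split_indicator)
    also have "\<dots> < \<infinity>"
      by (rule order.strict_trans1[OF nn_integral_defect_near[of b 1]]) (use b in auto)
    finally show "(\<integral>\<^sup>+w. ennreal (norm (complex_of_real (defect w powr b * indicator (annulus \<delta>) w))) \<partial>disc_area) < \<infinity>" .
  qed measurable
  from integrable_norm[OF cauchy_transform_integrable[OF this z(1)]]
  have int: "integrable disc_area ?k"
    by (simp add: norm_divide norm_mult abs_mult)
  have "weighted_op a (S_kernel b 1) (indicator (annulus \<delta>)) z = complex_of_real (defect z powr a * (LINT w|disc_area. ?k w))"
  proof -
    have eq: "(LINT w|disc_area. S_kernel b 1 z w * indicator (annulus \<delta>) w) = (LINT w|disc_area. complex_of_real (?k w))"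
      by (intro Bochner_Integration.integral_cong refl)
         (auto simp: S_kernel_def defect_def split: split_indicator)
    show ?thesis
      unfolding weighted_op_def eq integral_complex_of_real of_real_mult defect_def ..
  qed
  moreover have "0 \<le> (LINT w|disc_area. ?k w)"
    by (intro integral_nonneg_AE) auto
  ultimately have norm_eq: "norm (weighted_op a (S_kernel b 1) (indicator (annulus \<delta>)) z) = defect z powr a * (LINT w|disc_area. ?k w)"
    by (simp only: norm_of_real abs_mult abs_of_nonneg powr_ge_zero)
  have "ennreal (?l * \<delta> powr (b + 1)) = ennreal ?l * (ennreal (\<delta> powr b) * ennreal \<delta>)"
    using l \<delta> by (simp add: powr_add flip: ennreal_mult')
  also have "\<dots> = (\<integral>\<^sup>+w. ennreal ?l * (ennreal (\<delta> powr b) * indicator (annulus \<delta>) w) \<partial>disc_area)"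
  proof -
    have [measurable]: "(\<lambda>w. indicator (annulus \<delta>) w :: ennreal) \<in> borel_measurable disc_area"
      by (rule borel_measurable_disc_area) measurable
    show ?thesis by (simp add: nn_integral_cmult nn_integral_annulus[OF \<delta>])
  qed
  also have "\<dots> \<le> (\<integral>\<^sup>+w. \<integral>\<^sup>+\<zeta>. ennreal (?k (w * \<zeta>)) \<partial>circle_measure \<partial>disc_area)"
  proof (rule nn_integral_mono)
    fix w assume "w \<in> space disc_area"
    then have w: "norm w < 1" by simp
    show "ennreal ?l * (ennreal (\<delta> powr b) * indicator (annulus \<delta>) w) \<le> (\<integral>\<^sup>+\<zeta>. ennreal (?k (w * \<zeta>)) \<partial>circle_measure)"
    proof (cases "w \<in> annulus \<delta>")
      case True
      have s: "0 < defect w" "defect w \<le> \<delta>" using True w by (auto simp: annulus_def defect_pos)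
      define u where "u = cnj z * w"
      have u: "norm u < 1" using norm_mult_cnj_less_1[of w z] w z by (simp add: u_def mult.commute)
      \<comment> \<open>Both squared moduli are at least \<open>1 - \<delta>\<close>, so the modulus
        of the product \<open>u\<close> is too.\<close>
      have "(1 - \<delta>) * (1 - \<delta>) \<le> (norm z)\<^sup>2 * (norm w)\<^sup>2"
        using z(2) s \<delta> by (intro mult_mono) (auto simp: annulus_def defect_def)
      then have "(1 - \<delta>)\<^sup>2 \<le> (norm u)\<^sup>2"
        by (simp add: u_def norm_mult power2_eq_square mult_ac)
      then have "1 - \<delta> \<le> norm u"
        by (rule power2_le_imp_le) simp
      then have "ennreal ?l \<le> (\<integral>\<^sup>+\<zeta>. ennreal (1 / norm (1 - u * \<zeta>)) \<partial>circle_measure)"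
        by (intro circle_mean_inverse_lower u) simp
      moreover have "\<delta> powr b \<le> defect w powr b"
        using s b by (intro powr_mono2') auto
      ultimately have "ennreal ?l * ennreal (\<delta> powr b) \<le> (\<integral>\<^sup>+\<zeta>. ennreal (1 / norm (1 - u * \<zeta>)) \<partial>circle_measure) * ennreal (defect w powr b)"
        by (intro mult_mono ennreal_leI) auto
      also have "\<dots> = (\<integral>\<^sup>+\<zeta>. ennreal (1 / norm (1 - u * \<zeta>)) * ennreal (defect w powr b) \<partial>circle_measure)"
        by (simp add: nn_integral_multc)
      also have "\<dots> = (\<integral>\<^sup>+\<zeta>. ennreal (?k (w * \<zeta>)) \<partial>circle_measure)"
      proof (intro nn_integral_cong_AE, use AE_circle_measure in eventually_elim)
        case (elim \<zeta>)
        have "1 - z * cnj (w * \<zeta>) = cnj (1 - u * \<zeta>)" by (simp add: u_def mult_ac)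
        then have n: "norm (1 - z * cnj (w * \<zeta>)) = norm (1 - u * \<zeta>)" by (simp only: complex_mod_cnj)
        show ?case
          unfolding n defect_mult_circle[OF elim] using True elim
          by (simp add: annulus_def defect_mult_circle ennreal_mult'[symmetric])
      qed
      finally show ?thesis using True by simp
    qed simp
  qed
  also have "\<dots> = (\<integral>\<^sup>+w. ennreal (?k w) \<partial>disc_area)"
    by (rule nn_integral_disc_area_polar[symmetric]) measurable
  also have "\<dots> = ennreal (LINT w|disc_area. ?k w)"
    by (intro nn_integral_eq_integral int) auto
  finally have "?l * \<delta> powr (b + 1) \<le> (LINT w|disc_area. ?k w)"
    by (simp add: integral_nonneg_AE)
  then show ?thesis
    unfolding norm_eq by (intro mult_left_mono) auto
qed

text \<open>The contradiction comes from the norm inequality itself and not from divergence: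
  \<open>S\<close> is finite on every test function used, but no constant survives as the annuli
  shrink.\<close>

lemma S_unbounded_critical:
  fixes a b :: real
  assumes a: "-1 < a" and b: "-1 < b" and ab: "a + b < -1"
  shows "\<not> S_bounded a b 1 (lorentz1_norm (1 / (b + 1))) (weak_norm (- (1 / a)))"
proof
  assume "S_bounded a b 1 (lorentz1_norm (1 / (b + 1))) (weak_norm (- (1 / a)))"
  then obtain C where C0: "0 \<le> C" and C: "\<And>f. f \<in> function_space (lorentz1_norm (1 / (b + 1))) \<Longrightarrow>
      weighted_op a (S_kernel b 1) f \<in> function_space (weak_norm (- (1 / a))) \<and>
      weak_norm (- (1 / a)) (weighted_op a (S_kernel b 1) f) \<le> ennreal C * lorentz1_norm (1 / (b + 1)) f"
    unfolding S_bounded_def weighted_op_bounded_def by blast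
  have a0: "a < 0" and b0: "b < 0" using assms by linarith+
  \<comment> \<open>The bound that an admissible \<open>C\<close> would force on
    \<open>ln (1 + pi / \<delta>)\<close>: \<open>4 * pi\<close> is the \<open>2 * pi\<close> of the
    mean estimate doubled by the halved level \<open>t\<close>.\<close>
  define X where "X = 4 * pi * C / (b + 1)"
  have X: "0 \<le> X" using C0 b by (simp add: X_def)
  \<comment> \<open>The extra \<open>- 1\<close> keeps \<open>\<delta>\<close> below 1 even when
    \<open>C\<close>, and hence \<open>X\<close>, is 0.\<close>
  define \<delta> where "\<delta> = exp (- X - 1)"
  have \<delta>: "0 < \<delta>" "\<delta> < 1" using X by (auto simp: \<delta>_def)
  have "exp X < pi / \<delta>"
  proof -
    have "exp X < exp (X + 1)" by simp
    also have "\<dots> < pi * exp (X + 1)" using pi_gt3 by simp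
    also have "\<dots> = pi / \<delta>" by (simp add: \<delta>_def exp_minus exp_add exp_diff field_simps)
    finally show ?thesis .
  qed
  then have "ln (exp X) < ln (1 + pi / \<delta>)"
    by (subst ln_less_cancel_iff) (auto simp: add_pos_pos \<delta> intro: order.strict_trans)
  then have ln: "X < ln (1 + pi / \<delta>)" by simp
  let ?l = "ln (1 + pi / \<delta>) / (2 * pi)"
  have l: "0 < ?l" using ln X by simp
  let ?f = "indicator (annulus \<delta>) :: complex \<Rightarrow> complex"
  let ?S = "weighted_op a (S_kernel b 1) ?f"
  have fm: "?f \<in> borel_measurable disc_area" by (rule borel_measurable_disc_area) measurable
  have nf: "lorentz1_norm (1 / (b + 1)) ?f = ennreal (\<delta> powr (b + 1) / (b + 1))"
    by (rule lorentz1_norm_annulus[OF \<delta> b])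
  have "?f \<in> function_space (lorentz1_norm (1 / (b + 1)))"
    using fm by (simp add: function_space_def nf)
  from C[OF this] have Sm: "?S \<in> borel_measurable disc_area"
    and Sb: "weak_norm (- (1 / a)) ?S \<le> ennreal C * ennreal (\<delta> powr (b + 1) / (b + 1))"
    by (auto simp: function_space_def nf)
  \<comment> \<open>Half of the lower bound for \<open>S\<close> on the annulus, since superlevel
    sets use a strict inequality.\<close>
  define t where "t = \<delta> powr a * (?l * \<delta> powr (b + 1)) / 2"
  have t: "0 < t"
    unfolding t_def using l \<delta> by (intro half_gt_zero mult_pos_pos) auto
  have "annulus \<delta> \<inter> ball 0 1 \<subseteq> superlevel ?S t"
  proof
    fix z assume "z \<in> annulus \<delta> \<inter> ball 0 1"
    then have z: "norm z < 1" "z \<in> annulus \<delta>" by auto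
    have "t < \<delta> powr a * (?l * \<delta> powr (b + 1))" using t by (simp add: t_def)
    also have "\<dots> \<le> defect z powr a * (?l * \<delta> powr (b + 1))"
      using z a0 l defect_pos[OF z(1)] by (intro mult_right_mono powr_mono2') (auto simp: annulus_def)
    also have "\<dots> \<le> norm (?S z)" by (rule S_annulus_lower[OF b b0 \<delta> z])
    finally show "z \<in> superlevel ?S t" using z by (simp add: superlevel_def)
  qed
  then have "measure disc_area (annulus \<delta> \<inter> ball 0 1) \<le> measure disc_area (superlevel ?S t)"
    by (intro disc.finite_measure_mono superlevel_sets Sm)
  then have "\<delta> powr (- a) \<le> measure disc_area (superlevel ?S t) powr (- a)"
    using \<delta> a0 by (intro powr_mono2) (auto simp: measure_annulus)
  then have "t * \<delta> powr (- a) \<le> t * measure disc_area (superlevel ?S t) powr (- a)"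
    using t by (intro mult_left_mono) auto
  \<comment> \<open>The area of the annulus, raised to \<open>- a\<close>, cancels
    \<open>\<delta> powr a\<close>. Both sides then carry \<open>\<delta> powr (b + 1)\<close> and
    only the logarithm is left to compare with \<open>C\<close>.\<close>
  moreover have "t * \<delta> powr (- a) = ?l * \<delta> powr (b + 1) / 2"
    using \<delta> by (simp add: t_def powr_minus field_simps)
  ultimately have "ennreal (?l * \<delta> powr (b + 1) / 2) \<le> ennreal (t * measure disc_area (superlevel ?S t) powr (1 / - (1 / a)))"
    by (intro ennreal_leI) simp
  also have "\<dots> \<le> weak_norm (- (1 / a)) ?S"
    unfolding weak_norm_def using t by (intro SUP_upper) auto
  also note Sb
  also have "ennreal C * ennreal (\<delta> powr (b + 1) / (b + 1)) = ennreal (C * (\<delta> powr (b + 1) / (b + 1)))"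
    using C0 by (simp only: ennreal_mult')
  finally have "?l * \<delta> powr (b + 1) / 2 \<le> C * (\<delta> powr (b + 1) / (b + 1))"
    using C0 b by simp
  then have "\<delta> powr (b + 1) * (?l / 2) \<le> \<delta> powr (b + 1) * (C / (b + 1))" by (simp add: mult.commute)
  then have "?l / 2 \<le> C / (b + 1)"
    by (rule mult_left_le_imp_le) (use \<delta> in simp)
  then have "ln (1 + pi / \<delta>) \<le> X" using b by (simp add: X_def field_simps)
  with ln show False by simp
qed

theorem theorem9p1:
  fixes a b :: real
  assumes "a > -1" and "b > -1" and "a + b < -1"
  shows "\<not> S_bounded a b 1 (lorentz1_norm (1 / (b + 1))) (weak_norm (- (1 / a))) \<and>
         T_bounded a b 1 (lorentz1_norm (1 / (b + 1))) (weak_norm (- (1 / a)))"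
  using S_unbounded_critical[OF assms] T_bounded_critical[OF assms] by simp

end
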